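(* Let $m>0$ and $\alpha>0$, and let $g_m$ be LeBrun's Taub--NUT Kähler metric on $\mathbb{C}^2$, i.e. the Kähler metric with Kähler form $\omega_m=\frac{i}{2}\partial\bar\partial\Phi_m$, where $\Phi_m=u^2+v^2+m(u^4+v^4)$ and $u,v\ge 0$ are the functions of $(z_1,z_2)\in\mathbb{C}^2$ defined implicitly by $|z_1|=e^{m(u^2-v^2)}u$, $|z_2|=e^{m(v^2-u^2)}v$. Then the Kähler manifold $(\mathbb{C}^2,\alpha g_m)$ admits no Kähler immersion into $(\mathbb{CP}^N,g_{\mathrm{FS}})$ for any $N\le\infty$. Moreover, already the restriction of $\alpha g_m$ to the axis $\{z_2=0\}$ fails Calabi's criterion at the origin, that is, this restricted metric is not $1$-resolvable of rank at most $N$ at the origin for any $N\le\infty$.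
   Context: A Kähler immersion is a holomorphic isometric immersion: a holomorphic map $F$ with $F^*g_{\mathrm{FS}}$ equal to the given metric. $\mathbb{CP}^N$ with $N\le\infty$ is the finite- or infinite-dimensional complex projective space ($\mathbb{CP}^\infty$ being the projectivization of the Hilbert space $\ell^2(\mathbb{C})$), and $g_{\mathrm{FS}}$ is the Fubini--Study metric, normalized so that in the affine chart $Z_0\neq 0$ with coordinates $w_j=Z_j/Z_0$ its Kähler form is $\frac{i}{2}\partial\bar\partial\log(1+\sum_j|w_j|^2)$. A Kähler potential of a metric is a real function $\Phi$ such that the Kähler form is $\frac{i}{2}\partial\bar\partial\Phi$; thus $\alpha g_m$ has potential $\alpha\Phi_m$. Calabi's criterion. Let $g$ be a real analytic Kähler metric with real analytic Kähler potential $\Phi$ near a point $p$. Polarize $\Phi$ to a holomorphic function $\hat\Phi(z,\bar w)$ of the coordinates of $z$ and the conjugate coordinates of $w$, with $\hat\Phi(z,\bar z)=\Phi(z)$. Calabi's diastasis at $p$ is $D_p(z)=\hat\Phi(z,\bar z)+\hat\Phi(p,\bar p)-\hat\Phi(z,\bar p)-\hat\Phi(p,\bar z)$. In local coordinates centred at $p$, expand $e^{D_p(z)}-1=\sum_{j,k}B_{jk}z^j\bar z^k$ over multi-indices. The metric is $1$-resolvable of rank at most $N$ at $p$ if the Hermitian matrix $(B_{jk})$ is positive semidefinite of rank at most $N$ (for $N=\infty$ there is no rank restriction). *)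

theory Defs
  imports "HOL-Analysis.Analysis"
begin

section \<open>Complex normed spaces\<close>

class complex_normed_vector = real_normed_vector +
  fixes scaleC :: "complex \<Rightarrow> 'a \<Rightarrow> 'a"  (infixr \<open>*\<^sub>C\<close> 75)
  assumes scaleC_add_right: "c *\<^sub>C (x + y) = c *\<^sub>C x + c *\<^sub>C y"
    and scaleC_add_left: "(c + d) *\<^sub>C x = c *\<^sub>C x + d *\<^sub>C x"
    and scaleC_scaleC: "c *\<^sub>C d *\<^sub>C x = (c * d) *\<^sub>C x"
    and scaleC_of_real: "complex_of_real r *\<^sub>C x = r *\<^sub>R x"
    and norm_scaleC: "norm (c *\<^sub>C x) = cmod c * norm x"

instantiation complex :: complex_normed_vector
begin
definition scaleC_complex :: "complex \<Rightarrow> complex \<Rightarrow> complex" where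
  "scaleC_complex c z = c * z"
instance
  by standard (auto simp: scaleC_complex_def algebra_simps norm_mult scaleR_conv_of_real)
end

instantiation vec :: (complex_normed_vector, finite) complex_normed_vector
begin
definition scaleC_vec :: "complex \<Rightarrow> 'a ^ 'b \<Rightarrow> 'a ^ 'b" where
  "scaleC_vec c x = (\<chi> i. c *\<^sub>C (x $ i))"
instance
proof
  fix c d :: complex and r :: real and x y :: "'a ^ 'b"
  show "norm (c *\<^sub>C x) = cmod c * norm x"
    by (simp add: norm_vec_def scaleC_vec_def norm_scaleC L2_set_right_distrib)
qed (simp_all add: vec_eq_iff scaleC_vec_def scaleC_add_right scaleC_add_left scaleC_scaleC
      scaleC_of_real)
end

instantiation prod :: (complex_normed_vector, complex_normed_vector) complex_normed_vector
begin
definition scaleC_prod :: "complex \<Rightarrow> 'a \<times> 'b \<Rightarrow> 'a \<times> 'b" where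
  "scaleC_prod c x = (c *\<^sub>C fst x, c *\<^sub>C snd x)"
instance
proof
  fix c d :: complex and r :: real and x y :: "'a \<times> 'b"
  have "sqrt ((cmod c * norm (fst x))\<^sup>2 + (cmod c * norm (snd x))\<^sup>2)
      = cmod c * sqrt ((norm (fst x))\<^sup>2 + (norm (snd x))\<^sup>2)"
    by (simp add: power_mult_distrib real_sqrt_mult flip: distrib_left)
  then show "norm (c *\<^sub>C x) = cmod c * norm x"
    by (simp add: norm_prod_def scaleC_prod_def norm_scaleC)
qed (simp_all add: prod_eq_iff scaleC_prod_def scaleC_add_right scaleC_add_left scaleC_scaleC
      scaleC_of_real)
end

definition complex_differentiable_at ::
    "('a::complex_normed_vector \<Rightarrow> 'b::complex_normed_vector) \<Rightarrow> 'a \<Rightarrow> bool" where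
  "complex_differentiable_at f x \<longleftrightarrow>
     (\<exists>f'. (f has_derivative f') (at x) \<and> (\<forall>c v. f' (c *\<^sub>C v) = c *\<^sub>C f' v))"


section \<open>Kaehler metrics given by a potential\<close>

definition dir_deriv :: "'a::real_vector \<Rightarrow> ('a \<Rightarrow> real) \<Rightarrow> 'a \<Rightarrow> real" where
  "dir_deriv X \<phi> x = deriv (\<lambda>t. \<phi> (x + t *\<^sub>R X)) 0"

text \<open>
  The real form \<open>\<omega> = (\<i>/2) \<partial>\<partial>-bar \<phi>\<close> is one quarter of \<open>dd\<^sup>c \<phi>\<close>, where \<open>d\<^sup>c \<phi> (X) = -d\<phi> (\<i>X)\<close>.
  For constant vector fields \<open>X\<close>, \<open>Y\<close> this gives
  \<open>\<omega>(X, Y) = (D\<^bsub>\<i>X\<^esub> D\<^bsub>Y\<^esub> \<phi> - D\<^bsub>X\<^esub> D\<^bsub>\<i>Y\<^esub> \<phi>) / 4\<close>, and the associated Riemannian metric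
  \<open>g(X, Y) = \<omega>(X, \<i>Y)\<close> is the one below. The potential \<open>|z|\<^sup>2\<close> on \<open>\<complex>\<^sup>n\<close> gives the Euclidean metric.
\<close>
definition kahler_metric ::
    "('a::complex_normed_vector \<Rightarrow> real) \<Rightarrow> 'a \<Rightarrow> 'a \<Rightarrow> 'a \<Rightarrow> real" where
  "kahler_metric \<phi> x X Y =
     (dir_deriv X (dir_deriv Y \<phi>) x + dir_deriv (\<i> *\<^sub>C X) (dir_deriv (\<i> *\<^sub>C Y) \<phi>) x) / 4"

text \<open>Restricting a metric to a complex linear subspace amounts to restricting its potential.\<close>
lemma kahler_metric_pullback_linear:
  assumes L: "linear L" and LC: "\<And>c v. L (c *\<^sub>C v) = c *\<^sub>C L v"
  shows "kahler_metric (\<lambda>z. \<phi> (L z)) x X Y = kahler_metric \<phi> (L x) (L X) (L Y)"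
  by (simp add: kahler_metric_def dir_deriv_def linear_add[OF L] linear_scale[OF L] LC)


section \<open>The Hilbert space of square-summable complex sequences\<close>

typedef ell2 = "{x :: nat \<Rightarrow> complex. summable (\<lambda>j. (cmod (x j))\<^sup>2)}"
  morphisms coord Abs_ell2
  by (rule exI[of _ "\<lambda>_. 0"]) simp

setup_lifting type_definition_ell2

lemma summable_coord: "summable (\<lambda>j. (cmod (coord x j))\<^sup>2)"
  using coord[of x] by simp

lemma ell2_eqI: "(\<And>j. coord x j = coord y j) \<Longrightarrow> x = y"
  by (simp add: coord_inject[symmetric] fun_eq_iff)

lemma square_summable_add:
  fixes x y :: "nat \<Rightarrow> complex"
  assumes "summable (\<lambda>j. (cmod (x j))\<^sup>2)" "summable (\<lambda>j. (cmod (y j))\<^sup>2)"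
  shows "summable (\<lambda>j. (cmod (x j + y j))\<^sup>2)"
proof (rule summable_comparison_test')
  show "summable (\<lambda>j. 2 * (cmod (x j))\<^sup>2 + 2 * (cmod (y j))\<^sup>2)"
    using assms by (intro summable_add summable_mult)
  fix j
  have "(cmod (x j + y j))\<^sup>2 \<le> (cmod (x j) + cmod (y j))\<^sup>2"
    by (intro power_mono norm_triangle_ineq) auto
  also have "\<dots> \<le> 2 * (cmod (x j))\<^sup>2 + 2 * (cmod (y j))\<^sup>2"
    using sum_squares_bound[of "cmod (x j)" "cmod (y j)"] by (simp add: power2_sum)
  finally show "norm ((cmod (x j + y j))\<^sup>2) \<le> 2 * (cmod (x j))\<^sup>2 + 2 * (cmod (y j))\<^sup>2"
    by simp
qed

lemma square_summable_mult:
  fixes x :: "nat \<Rightarrow> complex"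
  assumes "summable (\<lambda>j. (cmod (x j))\<^sup>2)"
  shows "summable (\<lambda>j. (cmod (c * x j))\<^sup>2)"
  using summable_mult[OF assms, of "(cmod c)\<^sup>2"] by (simp add: norm_mult power_mult_distrib)

lemma summable_inner_coord: "summable (\<lambda>j. coord x j \<bullet> coord y j)"
proof (rule summable_comparison_test')
  show "summable (\<lambda>j. (cmod (coord x j))\<^sup>2 + (cmod (coord y j))\<^sup>2)"
    by (intro summable_add summable_coord)
  fix j
  have "\<bar>coord x j \<bullet> coord y j\<bar> \<le> cmod (coord x j) * cmod (coord y j)"
    by (rule Cauchy_Schwarz_ineq2)
  also have "\<dots> \<le> (cmod (coord x j))\<^sup>2 + (cmod (coord y j))\<^sup>2"
    using sum_squares_bound[of "cmod (coord x j)" "cmod (coord y j)"]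
      mult_nonneg_nonneg[OF norm_ge_zero[of "coord x j"] norm_ge_zero[of "coord y j"]]
    by linarith
  finally show "norm (coord x j \<bullet> coord y j) \<le> (cmod (coord x j))\<^sup>2 + (cmod (coord y j))\<^sup>2"
    by simp
qed

instantiation ell2 :: real_inner
begin

lift_definition zero_ell2 :: ell2 is "\<lambda>_. 0" by simp
lift_definition plus_ell2 :: "ell2 \<Rightarrow> ell2 \<Rightarrow> ell2" is "\<lambda>x y j. x j + y j"
  by (rule square_summable_add)
lift_definition uminus_ell2 :: "ell2 \<Rightarrow> ell2" is "\<lambda>x j. - x j" by simp
lift_definition minus_ell2 :: "ell2 \<Rightarrow> ell2 \<Rightarrow> ell2" is "\<lambda>x y j. x j - y j"
  using square_summable_add[of _ "\<lambda>j. - y j" for y] by fastforce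
lift_definition scaleR_ell2 :: "real \<Rightarrow> ell2 \<Rightarrow> ell2" is "\<lambda>r x j. complex_of_real r * x j"
  by (rule square_summable_mult)

definition inner_ell2 :: "ell2 \<Rightarrow> ell2 \<Rightarrow> real" where
  "inner_ell2 x y = (\<Sum>j. coord x j \<bullet> coord y j)"
definition norm_ell2 :: "ell2 \<Rightarrow> real" where
  "norm_ell2 x = sqrt (x \<bullet> x)"
definition dist_ell2 :: "ell2 \<Rightarrow> ell2 \<Rightarrow> real" where
  "dist_ell2 x y = norm (x - y)"
definition sgn_ell2 :: "ell2 \<Rightarrow> ell2" where
  "sgn_ell2 x = inverse (norm x) *\<^sub>R x"
definition uniformity_ell2 :: "(ell2 \<times> ell2) filter" where
  "uniformity_ell2 = (INF e\<in>{0<..}. principal {(x, y). dist x y < e})"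
definition open_ell2 :: "ell2 set \<Rightarrow> bool" where
  "open_ell2 U \<longleftrightarrow> (\<forall>x\<in>U. \<forall>\<^sub>F (x', y) in uniformity. x' = x \<longrightarrow> y \<in> U)"

instance
proof
  fix r s :: real and x y z :: ell2
  show "x + y + z = x + (y + z)" "x + y = y + x" "0 + x = x" "- x + x = 0" "x - y = x + - y"
    "r *\<^sub>R (x + y) = r *\<^sub>R x + r *\<^sub>R y" "(r + s) *\<^sub>R x = r *\<^sub>R x + s *\<^sub>R x"
    "r *\<^sub>R s *\<^sub>R x = (r * s) *\<^sub>R x" "1 *\<^sub>R x = x"
    by (transfer, simp add: fun_eq_iff algebra_simps)+
  show "dist x y = norm (x - y)" "sgn x = inverse (norm x) *\<^sub>R x" "norm x = sqrt (x \<bullet> x)"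
    by (simp_all add: dist_ell2_def sgn_ell2_def norm_ell2_def)
  show "(uniformity :: (ell2 \<times> ell2) filter) = (INF e\<in>{0<..}. principal {(x, y). dist x y < e})"
    by (rule uniformity_ell2_def)
  show "open U \<longleftrightarrow> (\<forall>x\<in>U. \<forall>\<^sub>F (x', y) in uniformity. x' = x \<longrightarrow> y \<in> U)" for U :: "ell2 set"
    by (rule open_ell2_def)
  show "x \<bullet> y = y \<bullet> x" by (simp add: inner_ell2_def inner_commute)
  show "(x + y) \<bullet> z = x \<bullet> z + y \<bullet> z"
    unfolding inner_ell2_def plus_ell2.rep_eq inner_add_left
    by (intro suminf_add[symmetric] summable_inner_coord)
  show "(r *\<^sub>R x) \<bullet> y = r * (x \<bullet> y)"
    using suminf_mult[OF summable_inner_coord[of x y], of r]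
    by (simp add: inner_ell2_def scaleR_ell2.rep_eq flip: scaleR_conv_of_real)
  show "0 \<le> x \<bullet> x"
    unfolding inner_ell2_def by (intro suminf_nonneg summable_inner_coord) simp
  have "x \<bullet> x = 0 \<longleftrightarrow> (\<forall>j. coord x j \<bullet> coord x j = 0)"
    unfolding inner_ell2_def by (intro suminf_eq_zero_iff summable_inner_coord) simp
  also have "\<dots> \<longleftrightarrow> x = 0"
    by (auto intro: ell2_eqI simp: zero_ell2.rep_eq)
  finally show "x \<bullet> x = 0 \<longleftrightarrow> x = 0" .
qed

end

lemma norm_ell2_sq: "(norm x)\<^sup>2 = (\<Sum>j. (cmod (coord x j))\<^sup>2)" for x :: ell2
  by (simp add: power2_norm_eq_inner inner_ell2_def)

instantiation ell2 :: complex_normed_vector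
begin

lift_definition scaleC_ell2 :: "complex \<Rightarrow> ell2 \<Rightarrow> ell2" is "\<lambda>c x j. c * x j"
  by (rule square_summable_mult)

instance
proof
  fix c d :: complex and r :: real and x y :: ell2
  show "c *\<^sub>C (x + y) = c *\<^sub>C x + c *\<^sub>C y" "(c + d) *\<^sub>C x = c *\<^sub>C x + d *\<^sub>C x"
    "c *\<^sub>C d *\<^sub>C x = (c * d) *\<^sub>C x" "complex_of_real r *\<^sub>C x = r *\<^sub>R x"
    by (transfer, simp add: fun_eq_iff algebra_simps)+
  have "(norm (c *\<^sub>C x))\<^sup>2 = (cmod c * norm x)\<^sup>2"
    using suminf_mult[OF summable_coord[of x], of "(cmod c)\<^sup>2"]
    by (simp add: norm_ell2_sq scaleC_ell2.rep_eq norm_mult power_mult_distrib)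
  then show "norm (c *\<^sub>C x) = cmod c * norm x"
    by simp
qed

end

lift_definition unit_ell2 :: "nat \<Rightarrow> ell2" is "\<lambda>k j. if j = k then 1 else 0"
proof -
  fix k :: nat
  show "summable (\<lambda>j. (cmod (if j = k then 1 else 0))\<^sup>2)"
    by (rule summable_finite[of "{k}"]) auto
qed


section \<open>Complex projective space with the Fubini--Study metric\<close>

definition complex_line :: "ell2 \<Rightarrow> ell2 set" where
  "complex_line x = range (\<lambda>c. c *\<^sub>C x)"

text \<open>
  The case \<open>N = \<infinity>\<close> is the projectivization of the whole Hilbert space; for finite \<open>N\<close> only the
  homogeneous coordinates \<open>Z\<^sub>0, \<dots>, Z\<^sub>N\<close> may be nonzero.
\<close>
definition CP :: "enat \<Rightarrow> ell2 set set" where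
  "CP N = {complex_line x | x. x \<noteq> 0 \<and> (\<forall>j. enat j > N \<longrightarrow> coord x j = 0)}"

definition affine_domain :: "nat \<Rightarrow> ell2 set set" where
  "affine_domain k = {l. \<exists>x\<in>l. coord x k \<noteq> 0}"

text \<open>
  The chart \<open>w\<^sub>j = Z\<^sub>j / Z\<^sub>k\<close> for \<open>j \<noteq> k\<close>, with values in the hyperplane \<open>w\<^sub>k = 0\<close>;
  see \<open>coord_affine_chart\<close>.
\<close>
definition affine_chart :: "nat \<Rightarrow> ell2 set \<Rightarrow> ell2" where
  "affine_chart k l = (THE w. coord w k = 0 \<and> w + unit_ell2 k \<in> l)"

lemma coord_affine_chart:
  assumes "coord x k \<noteq> 0"
  shows "coord (affine_chart k (complex_line x)) j = (if j = k then 0 else coord x j / coord x k)"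
proof -
  define w where "w = inverse (coord x k) *\<^sub>C x - unit_ell2 k"
  have w: "coord w j = (if j = k then 0 else coord x j / coord x k)" for j
    using assms by (simp add: w_def minus_ell2.rep_eq scaleC_ell2.rep_eq unit_ell2.rep_eq field_simps)
  have "affine_chart k (complex_line x) = w"
    unfolding affine_chart_def
  proof (rule the_equality)
    have "w + unit_ell2 k = inverse (coord x k) *\<^sub>C x" by (simp add: w_def)
    then show "coord w k = 0 \<and> w + unit_ell2 k \<in> complex_line x"
      by (auto simp: w complex_line_def)
  next
    fix v assume v: "coord v k = 0 \<and> v + unit_ell2 k \<in> complex_line x"
    then obtain c where c: "v + unit_ell2 k = c *\<^sub>C x" by (auto simp: complex_line_def)
    have *: "coord v j + (if j = k then 1 else 0) = c * coord x j" for j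
      using arg_cong[OF c, of "\<lambda>y. coord y j"]
      by (simp add: plus_ell2.rep_eq scaleC_ell2.rep_eq unit_ell2.rep_eq)
    have "1 = c * coord x k"
      using *[of k] v by simp
    then have "c = inverse (coord x k)"
      by (metis assms nonzero_eq_divide_eq inverse_eq_divide)
    then have "v + unit_ell2 k = w + unit_ell2 k"
      using c by (simp add: w_def)
    then show "v = w" by simp
  qed
  with w show ?thesis by simp
qed

definition fubini_study_potential :: "ell2 \<Rightarrow> real" where
  "fubini_study_potential w = ln (1 + (norm w)\<^sup>2)"

definition holomorphic_into_CP :: "enat \<Rightarrow> ('a::complex_normed_vector \<Rightarrow> ell2 set) \<Rightarrow> bool" where
  "holomorphic_into_CP N F \<longleftrightarrow> range F \<subseteq> CP N \<and>
     (\<forall>p k. F p \<in> affine_domain k \<longrightarrow>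
        (\<forall>\<^sub>F q in nhds p. F q \<in> affine_domain k) \<and>
        complex_differentiable_at (\<lambda>q. affine_chart k (F q)) p)"

definition kahler_immersion ::
    "('a::complex_normed_vector \<Rightarrow> 'a \<Rightarrow> 'a \<Rightarrow> real) \<Rightarrow> enat \<Rightarrow> ('a \<Rightarrow> ell2 set) \<Rightarrow> bool" where
  "kahler_immersion g N F \<longleftrightarrow> holomorphic_into_CP N F \<and>
     (\<forall>p k. F p \<in> affine_domain k \<longrightarrow>
        (let f = (\<lambda>q. affine_chart k (F q)); f' = frechet_derivative f (at p)
         in \<forall>X Y. kahler_metric fubini_study_potential (f p) (f' X) (f' Y) = g p X Y))"


section \<open>Calabi's criterion\<close>

definition vcnj :: "complex ^ 'n \<Rightarrow> complex ^ 'n" where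
  "vcnj z = (\<chi> i. cnj (z $ i))"

definition monomial :: "('n \<Rightarrow> nat) \<Rightarrow> complex ^ 'n::finite \<Rightarrow> complex" where
  "monomial j z = (\<Prod>i\<in>UNIV. (z $ i) ^ j i)"

definition is_polarization ::
    "(complex ^ 'n::finite \<Rightarrow> real) \<Rightarrow> complex ^ 'n
      \<Rightarrow> ((complex ^ 'n) \<times> (complex ^ 'n) \<Rightarrow> complex) \<Rightarrow> bool" where
  "is_polarization \<Phi> p P \<longleftrightarrow>
     (\<forall>\<^sub>F q in nhds (p, vcnj p). complex_differentiable_at P q) \<and>
     (\<forall>\<^sub>F z in nhds p. P (z, vcnj z) = complex_of_real (\<Phi> z))"

text \<open>
  For a real analytic \<open>\<Phi>\<close>, any two polarizations at \<open>p\<close> agree near \<open>(p, vcnj p)\<close>, so the germ of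
  the diastasis at \<open>p\<close>, and hence \<open>calabi_coeff\<close>, do not depend on the choice.
\<close>
definition diastasis ::
    "(complex ^ 'n::finite \<Rightarrow> real) \<Rightarrow> complex ^ 'n \<Rightarrow> complex ^ 'n \<Rightarrow> complex" where
  "diastasis \<Phi> p z = (let P = (SOME P. is_polarization \<Phi> p P)
     in P (z, vcnj z) + P (p, vcnj p) - P (z, vcnj p) - P (p, vcnj z))"

definition calabi_coeff ::
    "(complex ^ 'n::finite \<Rightarrow> real) \<Rightarrow> complex ^ 'n \<Rightarrow> ('n \<Rightarrow> nat) \<Rightarrow> ('n \<Rightarrow> nat) \<Rightarrow> complex" where
  "calabi_coeff \<Phi> p = (THE B. \<forall>\<^sub>F z in nhds 0.
     ((\<lambda>(j, k). B j k * monomial j z * cnj (monomial k z))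
        has_sum (exp (diastasis \<Phi> p (p + z)) - 1)) UNIV)"

definition hermitian_psd :: "('i \<Rightarrow> 'i \<Rightarrow> complex) \<Rightarrow> bool" where
  "hermitian_psd B \<longleftrightarrow> (\<forall>j k. B k j = cnj (B j k)) \<and>
     (\<forall>S c. finite S \<longrightarrow> 0 \<le> Re (\<Sum>j\<in>S. \<Sum>k\<in>S. B j k * c j * cnj (c k)))"

text \<open>Any family of more than \<open>N\<close> rows is linearly dependent; vacuous for \<open>N = \<infinity>\<close>.\<close>
definition rank_at_most :: "('i \<Rightarrow> 'i \<Rightarrow> complex) \<Rightarrow> enat \<Rightarrow> bool" where
  "rank_at_most B N \<longleftrightarrow> (\<forall>S. finite S \<and> enat (card S) > N \<longrightarrow>
     (\<exists>c. (\<exists>j\<in>S. c j \<noteq> 0) \<and> (\<forall>k. (\<Sum>j\<in>S. c j * B j k) = 0)))"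

text \<open>
  The metric enters through a real analytic Kaehler potential \<open>\<Phi>\<close> near \<open>p\<close>; adding the real part
  of a holomorphic function to \<open>\<Phi>\<close> does not change the diastasis.
\<close>
definition one_resolvable :: "(complex ^ 'n::finite \<Rightarrow> real) \<Rightarrow> complex ^ 'n \<Rightarrow> enat \<Rightarrow> bool" where
  "one_resolvable \<Phi> p N \<longleftrightarrow>
     hermitian_psd (calabi_coeff \<Phi> p) \<and> rank_at_most (calabi_coeff \<Phi> p) N"


section \<open>LeBrun's Taub--NUT metric\<close>

definition taub_nut_eqs :: "real \<Rightarrow> complex ^ 2 \<Rightarrow> real \<Rightarrow> real \<Rightarrow> bool" where
  "taub_nut_eqs m z u v \<longleftrightarrow> u \<ge> 0 \<and> v \<ge> 0 \<and>
     cmod (z $ 1) = exp (m * (u\<^sup>2 - v\<^sup>2)) * u \<and> cmod (z $ 2) = exp (m * (v\<^sup>2 - u\<^sup>2)) * v"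

lemma taub_nut_eqs_ex1:
  assumes m: "m > 0"
  shows "\<exists>!(u, v). taub_nut_eqs m z u v"
proof -
  define a b where "a = cmod (z $ 1)" and "b = cmod (z $ 2)"
  define h where "h s = s - (a * exp (- (m * s)))\<^sup>2 + (b * exp (m * s))\<^sup>2" for s
  have ab: "a \<ge> 0" "b \<ge> 0" by (simp_all add: a_def b_def)
  have mono: "h s < h t" if "s < t" for s t
  proof -
    have "(a * exp (- (m * t)))\<^sup>2 \<le> (a * exp (- (m * s)))\<^sup>2"
      using ab m that by (intro power_mono mult_left_mono) auto
    moreover have "(b * exp (m * s))\<^sup>2 \<le> (b * exp (m * t))\<^sup>2"
      using ab m that by (intro power_mono mult_left_mono) auto
    ultimately show ?thesis using that by (simp add: h_def)
  qed
  have inj: "s = t" if "h s = 0" "h t = 0" for s t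
    using mono[of s t] mono[of t s] that by linarith
  have solve: "c = exp t * w \<longleftrightarrow> w = c * exp (- t)" for c t w :: real
    by (auto simp: exp_minus field_simps)
  have eqs: "taub_nut_eqs m z u v \<longleftrightarrow>
      h (u\<^sup>2 - v\<^sup>2) = 0 \<and> u = a * exp (- (m * (u\<^sup>2 - v\<^sup>2))) \<and> v = b * exp (m * (u\<^sup>2 - v\<^sup>2))" for u v
  proof -
    have 1: "a = exp (m * (u\<^sup>2 - v\<^sup>2)) * u \<longleftrightarrow> u = a * exp (- (m * (u\<^sup>2 - v\<^sup>2)))"
      by (rule solve)
    have 2: "m * (v\<^sup>2 - u\<^sup>2) = - (m * (u\<^sup>2 - v\<^sup>2))"
      by (simp add: algebra_simps)
    have 3: "b = exp (m * (v\<^sup>2 - u\<^sup>2)) * v \<longleftrightarrow> v = b * exp (m * (u\<^sup>2 - v\<^sup>2))"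
      unfolding 2 solve by simp
    have 4: "h (u\<^sup>2 - v\<^sup>2) = 0" if "u = a * exp (- (m * (u\<^sup>2 - v\<^sup>2)))" "v = b * exp (m * (u\<^sup>2 - v\<^sup>2))"
      unfolding h_def that[symmetric] by simp
    have 5: "0 \<le> u" if "u = a * exp (- (m * (u\<^sup>2 - v\<^sup>2)))"
      by (subst that) (use ab in simp)
    have 6: "0 \<le> v" if "v = b * exp (m * (u\<^sup>2 - v\<^sup>2))"
      by (subst that) (use ab in simp)
    show ?thesis
      unfolding taub_nut_eqs_def a_def[symmetric] b_def[symmetric] 1 3 using 4 5 6 by blast
  qed
  have le: "- (b\<^sup>2) \<le> a\<^sup>2"
    using zero_le_power2[of a] zero_le_power2[of b] by linarith
  have "h (- (b\<^sup>2)) \<le> 0"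
  proof -
    have "(b * exp (m * (- (b\<^sup>2))))\<^sup>2 \<le> (b * 1)\<^sup>2"
      using ab m by (intro power_mono mult_left_mono) auto
    moreover have "0 \<le> (a * exp (- (m * (- (b\<^sup>2)))))\<^sup>2" by (rule zero_le_power2)
    moreover have "(b * 1)\<^sup>2 = b\<^sup>2" by simp
    ultimately show ?thesis unfolding h_def by linarith
  qed
  moreover have "0 \<le> h (a\<^sup>2)"
  proof -
    have "(a * exp (- (m * a\<^sup>2)))\<^sup>2 \<le> (a * 1)\<^sup>2"
      using ab m by (intro power_mono mult_left_mono) auto
    moreover have "0 \<le> (b * exp (m * a\<^sup>2))\<^sup>2" by (rule zero_le_power2)
    moreover have "(a * 1)\<^sup>2 = a\<^sup>2" by simp
    ultimately show ?thesis unfolding h_def by linarith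
  qed
  moreover have "continuous_on {- (b\<^sup>2)..a\<^sup>2} h"
    unfolding h_def by (intro continuous_intros)
  ultimately obtain s where s: "h s = 0"
    using IVT'[of h "- (b\<^sup>2)" 0 "a\<^sup>2"] le by blast
  define u v where "u = a * exp (- (m * s))" and "v = b * exp (m * s)"
  have uv: "u\<^sup>2 - v\<^sup>2 = s" using s by (simp add: h_def u_def v_def)
  show ?thesis
  proof (rule ex1I[of _ "(u, v)"])
    have "taub_nut_eqs m z u v" unfolding eqs uv using s by (simp add: u_def v_def)
    then show "case (u, v) of (u, v) \<Rightarrow> taub_nut_eqs m z u v" by simp
  next
    fix p assume "case p of (u, v) \<Rightarrow> taub_nut_eqs m z u v"
    then obtain u' v' where p: "p = (u', v')" and e: "taub_nut_eqs m z u' v'" by (cases p) auto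
    have "u'\<^sup>2 - v'\<^sup>2 = s" using e[unfolded eqs] s inj by blast
    with e[unfolded eqs] show "p = (u, v)" by (simp add: p u_def v_def)
  qed
qed

definition taub_nut_uv :: "real \<Rightarrow> complex ^ 2 \<Rightarrow> real \<times> real" where
  "taub_nut_uv m z = (THE (u, v). taub_nut_eqs m z u v)"

definition taub_nut_potential :: "real \<Rightarrow> complex ^ 2 \<Rightarrow> real" where
  "taub_nut_potential m z = (let (u, v) = taub_nut_uv m z in u\<^sup>2 + v\<^sup>2 + m * (u ^ 4 + v ^ 4))"

definition taub_nut_metric :: "real \<Rightarrow> complex ^ 2 \<Rightarrow> complex ^ 2 \<Rightarrow> complex ^ 2 \<Rightarrow> real" where
  "taub_nut_metric m = kahler_metric (taub_nut_potential m)"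

text \<open>The inclusion of the axis \<open>{z\<^sub>2 = 0}\<close>.\<close>
definition axis_incl :: "complex ^ 1 \<Rightarrow> complex ^ 2" where
  "axis_incl z = vector [z $ 1, 0]"

lemma kahler_metric_axis:
  "kahler_metric (\<lambda>z. \<phi> (axis_incl z)) x X Y
     = kahler_metric \<phi> (axis_incl x) (axis_incl X) (axis_incl Y)"
proof (rule kahler_metric_pullback_linear)
  show "linear axis_incl"
    by (rule linearI) (simp_all add: axis_incl_def vec_eq_iff forall_2)
  show "axis_incl (c *\<^sub>C v) = c *\<^sub>C axis_incl v" for c v
    by (simp add: axis_incl_def vec_eq_iff forall_2 scaleC_vec_def scaleC_complex_def)
qed

end

theory Submission
  imports Defs "HOL-Complex_Analysis.Complex_Analysis"
begin

no_notation fps_nth (infixl \<open>$\<close> 75)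

text \<open>
  On the axis put \<open>s = u\<^sup>2\<close> and \<open>x = |z\<^sub>1|\<^sup>2\<close>. Then \<open>x = s exp (2 m s)\<close> and the potential is
  \<open>s + m s\<^sup>2\<close>, a holomorphic function of \<open>x\<close> near \<open>0\<close>. As it is radial, Calabi's matrix at the origin is
  diagonal, with the Taylor coefficients \<open>a\<^sub>n\<close> of \<open>exp (\<alpha> (s + m s\<^sup>2))\<close> in \<open>x\<close> as entries for \<open>n > 0\<close>.
  With \<open>c = 2 m\<close>, Lagrange inversion gives
  \<open>n a\<^sub>n = [s\<^bsup>n-1\<^esup>] \<alpha> (1 + c s) exp (\<alpha> (s + m s\<^sup>2) - c n s)\<close>. For \<open>c n > \<alpha>\<close> the coefficients of
  the exponential alternate in sign, and those of index \<open>n - 1\<close> and \<open>n - 2\<close> have absolute values whose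
  ratio exceeds \<open>c\<close> for large \<open>n\<close>; so \<open>a\<^sub>n < 0\<close> for every large even \<open>n\<close>.

  A Kaehler immersion restricts to a holomorphic curve \<open>h\<close> in an affine chart over the axis, for which
  \<open>ln (1 + |h|\<^sup>2)\<close> differs from the potential by the real part of a holomorphic function. Hence
  \<open>exp (\<alpha> (s + m s\<^sup>2)) = \<Sum>\<^sub>j |g\<^sub>j|\<^sup>2\<close> with \<open>g\<^sub>j\<close> holomorphic, and comparing coefficients of \<open>z\<^sup>n\<close> times its
  conjugate yields \<open>a\<^sub>n \<ge> 0\<close> for all \<open>n\<close>, a contradiction.
\<close>

section \<open>Signs of the Taylor coefficients by Lagrange inversion\<close>

text \<open>As \<open>G\<close> has no constant term, \<open>G ^ k\<close> starts in degree
  \<open>k\<close>. All coefficients of \<open>A oo G\<close> up to degree \<open>n\<close> can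
  therefore be summed over the same range \<open>k \<le> n\<close>, which lets the two sums be
  exchanged.\<close>

lemma fps_compose_mult_nth:
  fixes A G Q :: "'a::field_char_0 fps"
  assumes "fps_nth G 0 = 0"
  shows "fps_nth ((A oo G) * Q) n = (\<Sum>k\<le>n. fps_nth A k * fps_nth (G ^ k * Q) n)"
proof -
  have comp: "fps_nth (A oo G) i = (\<Sum>k\<le>n. fps_nth A k * fps_nth (G ^ k) i)" if "i \<le> n" for i
    unfolding fps_compose_nth
    by (rule sum.mono_neutral_left) (use that assms in \<open>auto intro!: startsby_zero_power_prefix[rule_format]\<close>)
  have "fps_nth ((A oo G) * Q) n
      = (\<Sum>i=0..n. (\<Sum>k\<le>n. fps_nth A k * fps_nth (G ^ k) i) * fps_nth Q (n - i))"
    unfolding fps_mult_nth by (rule sum.cong) (auto simp: comp)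
  also have "\<dots> = (\<Sum>k\<le>n. \<Sum>i=0..n. fps_nth A k * (fps_nth (G ^ k) i * fps_nth Q (n - i)))"
    unfolding sum_distrib_right by (subst sum.swap) (simp add: mult.assoc)
  finally show ?thesis
    by (simp add: fps_mult_nth sum_distrib_left)
qed

text \<open>
  Lagrange inversion for \<open>x = s e\<^sup>c\<^sup>s\<close>: multiplying the derivative of the composite by
  \<open>e\<^sup>-\<^sup>n\<^sup>c\<^sup>s\<close> isolates a single coefficient of \<open>A\<close>.
\<close>
lemma fps_lagrange_X_exp:
  fixes A E :: "'a::field_char_0 fps"
  assumes "A oo (fps_X * fps_exp c) = E"
  shows "of_nat (Suc N) * fps_nth A (Suc N)
      = fps_nth (fps_deriv E * fps_exp (- (of_nat (Suc N) * c))) N"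
proof -
  let ?G = "fps_X * fps_exp c"
  let ?Q = "fps_deriv ?G * fps_exp (- (of_nat (Suc N) * c))"
  \<comment> \<open>The derivative of \<open>?G\<close> is \<open>(1 + c X) exp (c X)\<close>, so
    all exponentials merge into one with exponent \<open>(k - N) c\<close>.\<close>
  have pow: "?G ^ k * ?Q = fps_X ^ k * ((1 + fps_const c * fps_X) * fps_exp ((of_nat k - of_nat N) * c))"
    for k
  proof -
    have "(of_nat k - of_nat N) * c = of_nat k * c + (c + - (of_nat (Suc N) * c))"
      by (simp add: algebra_simps)
    then have "fps_exp ((of_nat k - of_nat N) * c)
        = fps_exp (of_nat k * c) * (fps_exp c * fps_exp (- (of_nat (Suc N) * c)))"
      by (simp only: fps_exp_add_mult)
    moreover have "fps_deriv ?G = (1 + fps_const c * fps_X) * fps_exp c"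
      by (simp add: algebra_simps)
    ultimately show ?thesis
      by (simp only: power_mult_distrib fps_exp_power_mult mult_ac)
  qed
  \<comment> \<open>With \<open>d = N - k > 0\<close> the coefficient is
    \<open>(-dc)^d / d! + c (-dc)^(d-1) / (d-1)!\<close>, and the two terms cancel. Only
    \<open>k = N\<close> survives.\<close>
  have nth: "fps_nth (?G ^ k * ?Q) N = (if k = N then 1 else 0)" if kN: "k \<le> N" for k
  proof -
    obtain d where N: "N = k + d" using kN le_Suc_ex by blast
    have "fps_nth (?G ^ k * ?Q) N
        = fps_nth ((1 + fps_const c * fps_X) * fps_exp (- (of_nat d * c))) d"
      unfolding pow by (simp add: N fps_X_power_mult_nth)
    also have "\<dots> = (if d = 0 then 1 else 0)"
    proof (cases d)
      case (Suc e)
      have "(1 + fps_const c * fps_X) * fps_exp (- (of_nat d * c))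
          = fps_exp (- (of_nat d * c)) + fps_const c * (fps_X * fps_exp (- (of_nat d * c)))"
        by (simp add: algebra_simps)
      then show ?thesis
        by (simp add: Suc field_simps del: of_nat_Suc fact_Suc) (simp add: field_simps)
    qed (simp add: fps_mult_nth)
    finally show ?thesis by (simp add: N)
  qed
  have "fps_deriv E = (fps_deriv A oo ?G) * fps_deriv ?G"
    unfolding assms[symmetric] by (rule fps_compose_deriv) simp
  then have "fps_nth (fps_deriv E * fps_exp (- (of_nat (Suc N) * c))) N
      = fps_nth ((fps_deriv A oo ?G) * ?Q) N"
    by (simp only: mult.assoc)
  also have "\<dots> = (\<Sum>k\<le>N. fps_nth (fps_deriv A) k * fps_nth (?G ^ k * ?Q) N)"
    by (rule fps_compose_mult_nth) simp
  also have "\<dots> = (\<Sum>k\<le>N. fps_nth (fps_deriv A) k * (if k = N then 1 else 0))"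
    by (rule sum.cong) (simp_all only: nth atMost_iff)
  also have "\<dots> = fps_nth (fps_deriv A) N"
    by (simp add: mult_delta_right)
  finally show ?thesis by simp
qed

text \<open>The coefficients of \<open>exp (b s\<^sup>2 / 2 + y s)\<close>.\<close>
fun gauss_coeff :: "real \<Rightarrow> real \<Rightarrow> nat \<Rightarrow> real" where
  "gauss_coeff b y 0 = 1"
| "gauss_coeff b y (Suc 0) = y"
| "gauss_coeff b y (Suc (Suc k)) = (y * gauss_coeff b y (Suc k) + b * gauss_coeff b y k) / (k + 2)"

section \<open>Sign and growth of the coefficients of Gaussian exponentials\<close>

lemma gauss_coeff_pos:
  assumes "b > 0" "y > 0"
  shows "gauss_coeff b y k > 0"
  using assms by (induction b y k rule: gauss_coeff.induct) (auto intro!: divide_pos_pos add_pos_pos simp: add_nonneg_pos)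

text \<open>The two assumptions characterize \<open>exp (b X^2 / 2 - y X)\<close>, the generating
  series of \<open>gauss_coeff b y\<close> taken at \<open>-X\<close>; this causes the alternating
  sign. The recursion has order two, so the induction carries two consecutive coefficients.\<close>

lemma fps_nth_gauss:
  fixes H :: "complex fps"
  assumes H0: "fps_nth H 0 = 1"
    and H': "fps_deriv H = (fps_const (of_real b) * fps_X - fps_const (of_real y)) * H"
  shows "fps_nth H k = (-1) ^ k * of_real (gauss_coeff b y k)"
proof -
  have H'': "fps_deriv H = fps_const (of_real b) * (fps_X * H) - fps_const (of_real y) * H"
    unfolding H' by (simp add: algebra_simps)
  have rec: "of_nat (Suc k) * fps_nth H (Suc k)
      = of_real b * (if k = 0 then 0 else fps_nth H (k - 1)) - of_real y * fps_nth H k" for k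
    using arg_cong[OF H'', of "\<lambda>F. fps_nth F k"] by simp
  have "fps_nth H k = (-1) ^ k * of_real (gauss_coeff b y k) \<and>
        fps_nth H (Suc k) = (-1) ^ Suc k * of_real (gauss_coeff b y (Suc k))"
  proof (induction k)
    case 0
    show ?case using rec[of 0] H0 by simp
  next
    case (Suc k)
    have nz: "of_nat (Suc (Suc k)) \<noteq> (0 :: complex)" by (simp del: of_nat_Suc)
    have "of_nat (Suc (Suc k)) * fps_nth H (Suc (Suc k))
        = (-1) ^ k * of_real (b * gauss_coeff b y k + y * gauss_coeff b y (Suc k))"
      unfolding rec[of "Suc k"] using Suc by (simp add: algebra_simps)
    also have "b * gauss_coeff b y k + y * gauss_coeff b y (Suc k)
        = real (Suc (Suc k)) * gauss_coeff b y (Suc (Suc k))"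
      by (simp add: field_simps)
    also have "(-1) ^ k * complex_of_real (real (Suc (Suc k)) * gauss_coeff b y (Suc (Suc k)))
        = of_nat (Suc (Suc k)) * ((-1) ^ Suc (Suc k) * of_real (gauss_coeff b y (Suc (Suc k))))"
      by (simp del: of_nat_Suc gauss_coeff.simps)
    finally have "fps_nth H (Suc (Suc k)) = (-1) ^ Suc (Suc k) * of_real (gauss_coeff b y (Suc (Suc k)))"
      using nz mult_left_cancel by blast
    with Suc show ?case by blast
  qed
  then show ?thesis by blast
qed

text \<open>Inserting the recursion for index \<open>k + 3\<close> and
  \<open>y = c n - \<alpha>\<close> turns the claim into
  \<open>(\<alpha> - c) p (k + 2) < \<alpha> c p (k + 1)\<close>. This is clear for
  \<open>\<alpha> \<le> c\<close>; otherwise the recursion one step lower bounds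
  \<open>p (k + 2)\<close> by a multiple of \<open>p (k + 1)\<close>.\<close>

lemma gauss_coeff_ratio:
  fixes c \<alpha> :: real and k :: nat
  defines "n \<equiv> real k + 4"
  assumes c: "c > 0" and \<alpha>: "\<alpha> > 0" and n1: "c * n \<ge> 2 * \<alpha>" and n2: "c\<^sup>2 * n > 2 * \<alpha>\<^sup>2"
  shows "c * gauss_coeff (\<alpha> * c) (c * n - \<alpha>) (k + 2) < gauss_coeff (\<alpha> * c) (c * n - \<alpha>) (k + 3)"
proof -
  define y where "y = c * n - \<alpha>"
  define p where "p = gauss_coeff (\<alpha> * c) y"
  have npos: "n \<ge> 4" by (simp add: n_def)
  have y: "y > 0" "y \<ge> c * n / 2" "y \<le> c * n" using n1 \<alpha> by (auto simp: y_def)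
  have p: "p j > 0" for j unfolding p_def using y c \<alpha> by (intro gauss_coeff_pos) auto
  have rec: "(real j + 2) * p (Suc (Suc j)) = y * p (Suc j) + \<alpha> * c * p j" for j
    by (simp add: p_def field_simps)
  have r1: "(n - 1) * p (k + 3) = y * p (k + 2) + \<alpha> * c * p (k + 1)"
    using rec[of "k + 1"] by (simp add: n_def eval_nat_numeral algebra_simps)
  have r2: "(n - 2) * p (k + 2) = y * p (k + 1) + \<alpha> * c * p k"
    using rec[of k] by (simp add: n_def eval_nat_numeral algebra_simps)
  \<comment> \<open>The recursion one more step down, with its last summand dropped; for
    \<open>k = 0\<close> it is an equality.\<close>
  have r3: "y * p k \<le> (n - 3) * p (k + 1)"
  proof (cases k)
    case 0
    then show ?thesis by (simp add: p_def n_def)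
  next
    case (Suc j)
    then show ?thesis using rec[of j] p[of j] c \<alpha> by (simp add: n_def algebra_simps)
  qed
  have bound: "(\<alpha> - c) * p (k + 2) < \<alpha> * c * p (k + 1)"
  proof (cases "\<alpha> \<le> c")
    case True
    then have "(\<alpha> - c) * p (k + 2) \<le> 0"
      using p[of "k + 2"] by (simp add: mult_nonpos_nonneg)
    also have "0 < \<alpha> * c * p (k + 1)" using p c \<alpha> by simp
    finally show ?thesis .
  next
    case False
    have "c * n / 2 * p k \<le> y * p k" using y p[of k] by (intro mult_right_mono) auto
    also note r3
    also have "(n - 3) * p (k + 1) \<le> n * p (k + 1)" using p[of "k + 1"] by (intro mult_right_mono) auto
    finally have "n * (c * p k) \<le> n * (2 * p (k + 1))" by (simp add: algebra_simps)
    then have "c * p k \<le> 2 * p (k + 1)" using npos by (simp add: mult_le_cancel_left)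
    then have "\<alpha> * (c * p k) \<le> \<alpha> * (2 * p (k + 1))"
      using \<alpha> by (intro mult_left_mono) auto
    moreover have "y * p (k + 1) \<le> c * n * p (k + 1)" using y p[of "k + 1"] by (intro mult_right_mono) auto
    ultimately have "(n - 2) * p (k + 2) \<le> (c * n + 2 * \<alpha>) * p (k + 1)"
      unfolding r2 by (simp add: algebra_simps)
    then have "(\<alpha> - c) * ((n - 2) * p (k + 2)) \<le> (\<alpha> - c) * ((c * n + 2 * \<alpha>) * p (k + 1))"
      using False by (intro mult_left_mono) auto
    also have "\<dots> = ((\<alpha> - c) * (c * n + 2 * \<alpha>)) * p (k + 1)" by simp
    \<comment> \<open>After expansion,
      \<open>(\<alpha> - c) (c n + 2 \<alpha>) < \<alpha> c (n - 2)\<close> is exactly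
      \<open>2 \<alpha>^2 < c^2 n\<close>, the assumption \<open>n2\<close>.\<close>
    also have "\<dots> < (\<alpha> * c * (n - 2)) * p (k + 1)"
      using n2 p[of "k + 1"] by (intro mult_strict_right_mono) (auto simp: algebra_simps power2_eq_square)
    finally have "(n - 2) * ((\<alpha> - c) * p (k + 2)) < (n - 2) * (\<alpha> * c * p (k + 1))"
      by (simp add: algebra_simps)
    then show ?thesis using npos by (simp add: mult_less_cancel_left)
  qed
  have "(n - 1) * (c * p (k + 2)) < (n - 1) * p (k + 3)"
    unfolding r1 using bound by (simp add: y_def algebra_simps)
  then have "c * p (k + 2) < p (k + 3)" using npos by (simp add: mult_less_cancel_left)
  then show ?thesis unfolding p_def y_def .
qed

lemma fps_taub_nut_negative_coeff:
  fixes A E :: "complex fps" and c \<alpha> :: real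
  assumes c: "c > 0" and \<alpha>: "\<alpha> > 0"
    and E0: "fps_nth E 0 = 1"
    and E': "fps_deriv E = fps_const (of_real \<alpha>) * (1 + fps_const (of_real c) * fps_X) * E"
    and AE: "A oo (fps_X * fps_exp (of_real c)) = E"
  obtains n where "n > 0" "Re (fps_nth A n) < 0"
proof -
  obtain k0 :: nat where k0: "real k0 > max (2 * \<alpha> / c) (2 * \<alpha>\<^sup>2 / c\<^sup>2)"
    using reals_Archimedean2 by blast
  \<comment> \<open>Evenness of \<open>k\<close> makes the index \<open>k + 3 = n - 1\<close> odd
    and \<open>k + 2 = n - 2\<close> even, which fixes the signs of the two coefficients of
    \<open>H\<close> below.\<close>
  define k where "k = 2 * k0"
  define n where "n = k + 4"
  have n: "real n = real k + 4" "real k0 \<le> real n" by (simp_all add: n_def k_def)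
  have n1: "c * (real k + 4) \<ge> 2 * \<alpha>" and n2: "c\<^sup>2 * (real k + 4) > 2 * \<alpha>\<^sup>2"
  proof -
    have "2 * \<alpha> / c \<le> real n" "2 * \<alpha>\<^sup>2 / c\<^sup>2 < real n" using k0 n by auto
    then show "c * (real k + 4) \<ge> 2 * \<alpha>" "c\<^sup>2 * (real k + 4) > 2 * \<alpha>\<^sup>2"
      using c n by (simp_all add: field_simps)
  qed
  define b y where "b = \<alpha> * c" and "y = c * real n - \<alpha>"
  \<comment> \<open>The exponential factor of the Lagrange formula shifts the logarithmic derivative
    \<open>\<alpha> (1 + c X)\<close> of \<open>E\<close> by \<open>- n c\<close>, giving
    \<open>b X - y\<close>.\<close>
  define H where "H = E * fps_exp (- (of_nat n * of_real c))"
  have H0: "fps_nth H 0 = 1" by (simp add: H_def E0)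
  have H': "fps_deriv H = (fps_const (of_real b) * fps_X - fps_const (of_real y)) * H"
    unfolding H_def b_def y_def
    by (simp add: E' algebra_simps flip: fps_const_mult fps_const_sub fps_const_neg)
  have h: "fps_nth H j = (-1) ^ j * of_real (gauss_coeff b y j)" for j
    using H0 H' by (rule fps_nth_gauss)
  have "n = Suc (Suc (k + 2))" by (simp add: n_def)
  then have "of_nat n * fps_nth A n = fps_nth (fps_deriv E * fps_exp (- (of_nat n * of_real c))) (k + 3)"
    using fps_lagrange_X_exp[OF AE, of "k + 3"] by (simp add: eval_nat_numeral)
  also have "fps_deriv E * fps_exp (- (of_nat n * of_real c))
      = fps_const (of_real \<alpha>) * (H + fps_const (of_real c) * (fps_X * H))"
    unfolding H_def E' by (simp add: algebra_simps)
  also have "fps_nth \<dots> (k + 3) = of_real (\<alpha> * (c * gauss_coeff b y (k + 2) - gauss_coeff b y (k + 3)))"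
  proof -
    have "fps_nth H (k + 2) = of_real (gauss_coeff b y (k + 2))"
      "fps_nth H (k + 3) = - of_real (gauss_coeff b y (k + 3))"
      unfolding h by (simp_all add: k_def power_add power_mult)
    then show ?thesis
      by (simp add: eval_nat_numeral algebra_simps del: gauss_coeff.simps)
  qed
  finally have eq: "of_nat n * fps_nth A n
      = complex_of_real (\<alpha> * (c * gauss_coeff b y (k + 2) - gauss_coeff b y (k + 3)))" .
  have "\<alpha> * (c * gauss_coeff b y (k + 2) - gauss_coeff b y (k + 3)) < 0"
    using gauss_coeff_ratio[OF c \<alpha> n1 n2] \<alpha> by (simp add: b_def y_def n mult_pos_neg)
  then have "real n * Re (fps_nth A n) < 0"
    using arg_cong[OF eq, of Re] by simp
  then have "Re (fps_nth A n) < 0" by (simp add: mult_less_0_iff)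
  moreover have "n > 0" by (simp add: n_def)
  ultimately show thesis using that by blast
qed

section \<open>The potential on the axis\<close>

text \<open>A nonzero coefficient of positive index would isolate the zero at 0, whereas the sum
  function vanishes identically. The constant term is read off at \<open>t = 0\<close>.\<close>

lemma real_powser_zero_coeff:
  fixes a :: "nat \<Rightarrow> real"
  assumes r: "r > 0" and s: "\<And>t. \<bar>t\<bar> < r \<Longrightarrow> (\<lambda>n. a n * t ^ n) sums 0"
  shows "a n = 0"
proof (cases "n = 0")
  case True
  have "(\<lambda>n. a n * 0 ^ n) sums 0" using s[of 0] r by simp
  then show ?thesis by (simp only: powser_sums_zero_iff True)
next
  case False
  show ?thesis
  proof (rule ccontr)
    assume an: "a n \<noteq> 0"
    show False
    proof (rule powser_0_nonzero[of r 0 a "\<lambda>_. 0" n])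
      show "(\<lambda>n. a n * (t - 0) ^ n) sums 0" if "norm (t - 0) < r" for t
        using s that by simp
    next
      fix d :: real
      assume d: "0 < d" "\<And>z::real. z \<in> cball 0 d - {0} \<Longrightarrow> (0::real) \<noteq> 0"
      have "d \<in> cball 0 d - {0}" using d(1) by simp
      then have "(0::real) \<noteq> 0" by (rule d(2))
      then show False by simp
    qed (use r an False in auto)
  qed
qed

text \<open>Along a ray \<open>z = t \<zeta>\<close> with \<open>\<zeta>\<close> on the unit circle,
  grouping by total degree gives a power series in the real variable \<open>t\<close>, so each
  homogeneous part vanishes on the circle. There a homogeneous part is, up to a power of
  \<open>\<zeta>\<close>, a polynomial in \<open>\<zeta>^2\<close>, which then has infinitely many
  roots.\<close>

lemma double_series_zero_coeff:
  fixes C :: "nat \<Rightarrow> nat \<Rightarrow> complex"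
  assumes r: "r > 0"
    and C: "\<And>z. cmod z < r \<Longrightarrow> ((\<lambda>(j, k). C j k * z ^ j * cnj z ^ k) has_sum 0) UNIV"
  shows "C j k = 0"
proof -
  define P where "P \<zeta> N = (\<Sum>j\<le>N. C j (N - j) * \<zeta> ^ j * cnj \<zeta> ^ (N - j))" for \<zeta> N
  \<comment> \<open>Pairs are listed by total degree \<open>N\<close> and first exponent
    \<open>j\<close>.\<close>
  have bij: "bij_betw (\<lambda>(N, j). (j, N - j)) (SIGMA N:UNIV. {..N}) (UNIV :: (nat \<times> nat) set)"
    by (rule bij_betwI[where g = "\<lambda>(j, k). (j + k, j)"]) auto
  have sums: "(\<lambda>N. of_real (t ^ N) * P \<zeta> N) sums 0" if \<zeta>: "cmod \<zeta> = 1" and t: "\<bar>t\<bar> < r" for \<zeta> and t :: real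
  proof -
    let ?f = "\<lambda>(j, k). C j k * (of_real t * \<zeta>) ^ j * cnj (of_real t * \<zeta>) ^ k"
    have "(?f has_sum 0) UNIV" by (rule C) (use \<zeta> t in \<open>simp add: norm_mult\<close>)
    then have "((\<lambda>x. ?f (case x of (N, j) \<Rightarrow> (j, N - j))) has_sum 0) (SIGMA N:UNIV. {..N})"
      using has_sum_reindex_bij_betw[OF bij, of ?f 0] by simp
    then have "((\<lambda>N. of_real (t ^ N) * P \<zeta> N) has_sum 0) UNIV"
    proof (rule has_sum_SigmaD)
      fix N
      have "(\<Sum>j\<le>N. C j (N - j) * (of_real t * \<zeta>) ^ j * cnj (of_real t * \<zeta>) ^ (N - j))
          = of_real (t ^ N) * P \<zeta> N"
        unfolding P_def sum_distrib_left
      proof (rule sum.cong[OF refl])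
        fix j assume "j \<in> {..N}"
        then have "complex_of_real (t ^ N) = of_real t ^ j * of_real t ^ (N - j)"
          by (simp flip: power_add)
        then show "C j (N - j) * (of_real t * \<zeta>) ^ j * cnj (of_real t * \<zeta>) ^ (N - j)
            = of_real (t ^ N) * (C j (N - j) * \<zeta> ^ j * cnj \<zeta> ^ (N - j))"
          by (simp only: power_mult_distrib complex_cnj_mult complex_cnj_complex_of_real mult_ac)
      qed
      then show "((\<lambda>y. ?f (case (N, y) of (N, j) \<Rightarrow> (j, N - j))) has_sum of_real (t ^ N) * P \<zeta> N) {..N}"
        by (intro has_sum_finiteI) simp_all
    qed
    then show ?thesis by (rule has_sum_imp_sums)
  qed
  have P0: "P \<zeta> N = 0" if "cmod \<zeta> = 1" for \<zeta> N
  proof -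
    have "(\<lambda>N. Re (P \<zeta> N) * t ^ N) sums 0" "(\<lambda>N. Im (P \<zeta> N) * t ^ N) sums 0" if "\<bar>t\<bar> < r" for t
      using sums_Re[OF sums[OF \<open>cmod \<zeta> = 1\<close> that]] sums_Im[OF sums[OF \<open>cmod \<zeta> = 1\<close> that]]
      by (simp_all add: mult.commute flip: of_real_power)
    then have "Re (P \<zeta> N) = 0" "Im (P \<zeta> N) = 0"
      using real_powser_zero_coeff[OF r, of "\<lambda>N. Re (P \<zeta> N)" N]
        real_powser_zero_coeff[OF r, of "\<lambda>N. Im (P \<zeta> N)" N] by simp_all
    then show ?thesis by (simp add: complex_eq_iff)
  qed
  define N where "N = j + k"
  \<comment> \<open>Every \<open>w\<close> on the circle is a square \<open>\<zeta>^2\<close>, and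
    \<open>\<zeta> * cnj \<zeta> = 1\<close> turns
    \<open>\<zeta> ^ N * cnj \<zeta> ^ (N - j)\<close> into \<open>\<zeta> ^ j\<close>.\<close>
  have root: "(\<Sum>j\<le>N. C j (N - j) * w ^ j) = 0" if w: "cmod w = 1" for w
  proof -
    define \<zeta> where "\<zeta> = csqrt w"
    have \<zeta>: "\<zeta>\<^sup>2 = w" "cmod \<zeta> = 1" using w by (simp_all add: \<zeta>_def)
    have u: "\<zeta> * cnj \<zeta> = 1" using \<zeta> by (simp add: complex_norm_square[symmetric])
    have "(\<Sum>j\<le>N. C j (N - j) * w ^ j) = \<zeta> ^ N * P \<zeta> N"
      unfolding P_def sum_distrib_left
    proof (rule sum.cong[OF refl])
      fix j assume "j \<in> {..N}"
      then have "\<zeta> ^ N = \<zeta> ^ j * \<zeta> ^ (N - j)" by (simp flip: power_add)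
      then have "\<zeta> ^ N * (C j (N - j) * \<zeta> ^ j * cnj \<zeta> ^ (N - j))
          = C j (N - j) * (\<zeta> * \<zeta>) ^ j * (\<zeta> * cnj \<zeta>) ^ (N - j)"
        by (simp only: power_mult_distrib mult_ac)
      then show "C j (N - j) * w ^ j = \<zeta> ^ N * (C j (N - j) * \<zeta> ^ j * cnj \<zeta> ^ (N - j))"
        using u \<zeta>(1) by (simp only: power2_eq_square power_one mult_1_right)
    qed
    then show ?thesis using P0 \<zeta> by simp
  qed
  \<comment> \<open>A finite connected set has at most one point, but the circle contains both 1 and
    -1.\<close>
  have inf: "infinite (sphere (0::complex) 1)"
    by (simp add: connected_finite_iff_sing connected_sphere)
       (metis norm_one singletonD mem_sphere_0 norm_minus_cancel one_neq_neg_one)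
  have "sphere 0 1 \<subseteq> {w. (\<Sum>j\<le>N. C j (N - j) * w ^ j) = 0}"
    using root by auto
  then have "infinite {w. (\<Sum>j\<le>N. C j (N - j) * w ^ j) = 0}"
    using inf finite_subset by blast
  then have "C j (N - j) = 0"
    using polyfun_finite_roots[of "\<lambda>j. C j (N - j)" N] by (metis N_def le_add1)
  then show ?thesis by (simp add: N_def)
qed

section \<open>The potential on the axis as a function of the squared modulus\<close>

text \<open>On the axis the second defining equation forces \<open>v = 0\<close>; the witness is
  \<open>s = u\<^sup>2\<close>, and the first equation is squared.\<close>

lemma taub_nut_potential_axis:
  fixes z :: "complex ^ 1"
  assumes m: "m > 0"
  obtains s where "s \<ge> 0" "(cmod (z $ 1))\<^sup>2 = s * exp (2 * m * s)"
    "taub_nut_potential m (axis_incl z) = s + m * s\<^sup>2"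
proof -
  obtain u v where uv: "taub_nut_uv m (axis_incl z) = (u, v)" by fastforce
  have "case taub_nut_uv m (axis_incl z) of (u, v) \<Rightarrow> taub_nut_eqs m (axis_incl z) u v"
    unfolding taub_nut_uv_def by (rule theI'[OF taub_nut_eqs_ex1[OF m]])
  then have e: "taub_nut_eqs m (axis_incl z) u v" by (simp add: uv)
  then have v: "v = 0" and u: "u \<ge> 0" "cmod (z $ 1) = exp (m * u\<^sup>2) * u"
    by (auto simp: taub_nut_eqs_def axis_incl_def)
  show thesis
  proof (rule that[of "u\<^sup>2"])
    show "(cmod (z $ 1))\<^sup>2 = u\<^sup>2 * exp (2 * m * u\<^sup>2)"
      by (simp add: u(2) power_mult_distrib mult_ac flip: exp_double)
    show "taub_nut_potential m (axis_incl z) = u\<^sup>2 + m * (u\<^sup>2)\<^sup>2"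
      by (simp add: taub_nut_potential_def uv v flip: power_mult)
  qed simp
qed

text \<open>\<open>T\<close> comes from the holomorphic local inverse of \<open>s \<mapsto> s e\<^sup>2\<^sup>m\<^sup>s\<close> at \<open>0\<close>.\<close>
lemma taub_nut_axis_holomorphic:
  fixes m \<alpha> :: real
  assumes m: "m > 0" and \<alpha>: "\<alpha> > 0"
  obtains T \<rho> where "\<rho> > 0" "T holomorphic_on ball 0 \<rho>" "T 0 = 0"
    "\<And>z. (cmod (z $ 1))\<^sup>2 < \<rho> \<Longrightarrow>
       T (of_real ((cmod (z $ 1))\<^sup>2)) = of_real (\<alpha> * taub_nut_potential m (axis_incl z))"
    "\<exists>n>0. Re (fps_nth (fps_expansion (\<lambda>x. exp (T x)) 0) n) < 0"
proof -
  define c where "c = 2 * m"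
  have c: "c > 0" using m by (simp add: c_def)
  define g where "g s = s * exp (of_real c * s)" for s :: complex
  have holg: "g holomorphic_on UNIV" unfolding g_def by (intro holomorphic_intros)
  have "(g has_field_derivative 1) (at 0)"
    unfolding g_def by (auto intro!: derivative_eq_intros)
  then have "deriv g 0 \<noteq> 0" by (simp add: DERIV_imp_deriv)
  then obtain r where r: "r > 0" and inj: "inj_on g (ball 0 r)"
    using has_complex_derivative_locally_injective[OF holg, of 0] by auto
  have holg': "g holomorphic_on ball 0 r" using holg holomorphic_on_subset by blast
  obtain S where holS: "S holomorphic_on g ` ball 0 r" and S: "\<And>s. s \<in> ball 0 r \<Longrightarrow> S (g s) = s"
    using holomorphic_has_inverse[OF holg' open_ball inj] by metis
  have "open (g ` ball 0 r)" by (rule open_mapping_thm3[OF holg' open_ball inj])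
  moreover have "0 \<in> g ` ball 0 r" using r by (auto simp: g_def intro!: image_eqI[of _ _ 0])
  ultimately obtain \<rho>0 where \<rho>0: "\<rho>0 > 0" "ball 0 \<rho>0 \<subseteq> g ` ball 0 r"
    using open_contains_ball_eq by blast
  \<comment> \<open>For the real solution, \<open>s \<le> s * exp (2 * m * s) < \<rho>\<close>. The
    bound by \<open>r\<close> thus places \<open>s\<close> in the ball where \<open>S\<close>
    inverts \<open>g\<close>, and the bound by \<open>\<rho>0\<close> keeps the argument in the
    domain of \<open>S\<close>.\<close>
  define \<rho> where "\<rho> = min r \<rho>0"
  define T where "T x = of_real \<alpha> * (S x + of_real m * (S x)\<^sup>2)" for x
  have \<rho>: "\<rho> > 0" "\<rho> \<le> r" using r \<rho>0 by (auto simp: \<rho>_def)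
  have holS': "S holomorphic_on ball 0 \<rho>"
    using holS \<rho>0 by (rule_tac holomorphic_on_subset) (auto simp: \<rho>_def)
  have holT: "T holomorphic_on ball 0 \<rho>"
    unfolding T_def by (intro holomorphic_intros holS')
  have T: "T (g s) = of_real \<alpha> * (s + of_real m * s\<^sup>2)" if "cmod s < r" for s
    using S that by (simp add: T_def)
  have T0: "T 0 = 0"
    using T[of 0] r by (simp add: g_def)
  have T_real: "T (of_real ((cmod (z $ 1))\<^sup>2)) = of_real (\<alpha> * taub_nut_potential m (axis_incl z))"
    if z: "(cmod (z $ 1))\<^sup>2 < \<rho>" for z :: "complex ^ 1"
  proof -
    obtain s where s: "s \<ge> 0" "(cmod (z $ 1))\<^sup>2 = s * exp (2 * m * s)"
      "taub_nut_potential m (axis_incl z) = s + m * s\<^sup>2"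
      using taub_nut_potential_axis[OF m] by blast
    have "s * 1 \<le> s * exp (2 * m * s)" using s(1) m by (intro mult_left_mono) auto
    then have "s < r" using z s \<rho> by simp
    moreover have "complex_of_real ((cmod (z $ 1))\<^sup>2) = g (of_real s)"
      unfolding s(2) g_def c_def by (simp flip: exp_of_real)
    ultimately show ?thesis using T[of "of_real s"] s by simp
  qed
  define e where "e s = exp (of_real \<alpha> * (s + of_real m * s\<^sup>2))" for s :: complex
  define A where "A = fps_expansion (\<lambda>x. exp (T x)) 0"
  define E where "E = fps_expansion e 0"
  have A: "(\<lambda>x. exp (T x)) has_fps_expansion A"
    unfolding A_def using holT \<rho> by (intro has_fps_expansion_fps_expansion[of "ball 0 \<rho>"] holomorphic_intros) auto
  have E: "e has_fps_expansion E"
    unfolding E_def e_def by (intro has_fps_expansion_fps_expansion[of UNIV] holomorphic_intros) auto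
  have g: "g has_fps_expansion (fps_X * fps_exp (of_real c))"
    unfolding g_def by (intro fps_expansion_intros)
  \<comment> \<open>Near 0 the composite of \<open>exp (T x)\<close> with \<open>g\<close> is the
    explicit function \<open>e\<close>. Uniqueness of expansions transfers this to formal series, as
    the Lagrange lemma requires.\<close>
  have "((\<lambda>x. exp (T x)) \<circ> g) has_fps_expansion (A oo (fps_X * fps_exp (of_real c)))"
    by (rule has_fps_expansion_compose[OF A g]) simp
  moreover have "\<forall>\<^sub>F s in nhds 0. ((\<lambda>x. exp (T x)) \<circ> g) s = e s"
    using eventually_nhds_in_open[OF open_ball, of "0::complex" 0 r] r
    by (auto elim!: eventually_mono simp: T e_def)
  ultimately have "e has_fps_expansion (A oo (fps_X * fps_exp (of_real c)))"
    using has_fps_expansion_cong by blast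
  then have AE: "A oo (fps_X * fps_exp (of_real c)) = E"
    using E fps_expansion_unique_complex by blast
  have "deriv e has_fps_expansion fps_deriv E"
    using E by (rule has_fps_expansion_deriv)
  moreover have "deriv e = (\<lambda>s. of_real \<alpha> * (1 + of_real c * s) * e s)"
    unfolding e_def c_def
    by (rule ext, rule DERIV_imp_deriv) (auto intro!: derivative_eq_intros simp: algebra_simps)
  moreover have "(\<lambda>s. of_real \<alpha> * (1 + of_real c * s) * e s) has_fps_expansion
      fps_const (of_real \<alpha>) * (1 + fps_const (of_real c) * fps_X) * E"
    by (intro fps_expansion_intros E)
  ultimately have E': "fps_deriv E = fps_const (of_real \<alpha>) * (1 + fps_const (of_real c) * fps_X) * E"
    using fps_expansion_unique_complex[of "deriv e"] by simp
  have "fps_nth E 0 = 1"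
    using fps_nth_fps_expansion[OF E, of 0] by (simp add: e_def)
  then obtain n where "n > 0" "Re (fps_nth A n) < 0"
    using fps_taub_nut_negative_coeff[OF c \<alpha> _ E' AE] by blast
  then show thesis using that[OF \<rho>(1) holT T0 T_real] by (auto simp: A_def)
qed

section \<open>Calabi's criterion on the axis\<close>

lemma has_sum_minus:
  fixes f g :: "'a \<Rightarrow> 'b::topological_ab_group_add"
  assumes "(f has_sum a) A" "(g has_sum b) A"
  shows "((\<lambda>x. f x - g x) has_sum (a - b)) A"
  using has_sum_add[OF assms(1), of "\<lambda>x. - g x" "- b"] assms(2) by (simp add: has_sum_uminus)

section \<open>Restriction to complex lines and uniqueness of the polarization\<close>

lemma bounded_linear_scaleC_left: "bounded_linear (\<lambda>c. c *\<^sub>C (v::'a::complex_normed_vector))"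
proof (rule bounded_linear_intro[where K = "norm v"])
  show "(c + d) *\<^sub>C v = c *\<^sub>C v + d *\<^sub>C v" for c d by (rule scaleC_add_left)
  show "(r *\<^sub>R c) *\<^sub>C v = r *\<^sub>R c *\<^sub>C v" for r c
    by (simp add: scaleR_conv_of_real flip: scaleC_scaleC scaleC_of_real)
  show "norm (c *\<^sub>C v) \<le> norm c * norm v" for c by (simp add: norm_scaleC)
qed

lemma field_differentiable_along_line:
  fixes f :: "'a::complex_normed_vector \<Rightarrow> complex"
  assumes "complex_differentiable_at f (p + t *\<^sub>C v)"
  shows "(\<lambda>s. f (p + s *\<^sub>C v)) field_differentiable (at t)"
proof -
  obtain f' where f': "(f has_derivative f') (at (p + t *\<^sub>C v))" "\<And>c v. f' (c *\<^sub>C v) = c *\<^sub>C f' v"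
    using assms unfolding complex_differentiable_at_def by blast
  have "((\<lambda>s. p + s *\<^sub>C v) has_derivative (\<lambda>s. s *\<^sub>C v)) (at t)"
    using has_derivative_add[OF has_derivative_const bounded_linear_imp_has_derivative[OF bounded_linear_scaleC_left]]
    by simp
  then have "((\<lambda>s. f (p + s *\<^sub>C v)) has_derivative (\<lambda>s. f' (s *\<^sub>C v))) (at t)"
    using f'(1) by (rule has_derivative_compose)
  moreover have "(\<lambda>s. f' (s *\<^sub>C v)) = (*) (f' v)"
    by (auto simp: f'(2) scaleC_complex_def mult.commute)
  ultimately show ?thesis
    unfolding field_differentiable_def has_field_derivative_def by auto
qed

lemma holomorphic_zero_on_reals:
  fixes f :: "complex \<Rightarrow> complex"
  assumes d: "d > 0" and hol: "f holomorphic_on ball 0 d"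
    and zero: "\<And>t::real. \<bar>t\<bar> < d \<Longrightarrow> f (of_real t) = 0"
    and w: "cmod w < d"
  shows "f w = 0"
proof (rule analytic_continuation[OF hol])
  show "of_real ` {- d<..<d} \<subseteq> ball (0::complex) d" by auto
  show "(0::complex) islimpt of_real ` {- d<..<d}"
    unfolding islimpt_approachable
  proof (intro allI impI)
    fix e :: real assume e: "e > 0"
    obtain t where t: "0 < t" "t < min d e" using dense[of 0 "min d e"] d e by auto
    show "\<exists>x'\<in>of_real ` {- d<..<d}. x' \<noteq> (0::complex) \<and> dist x' 0 < e"
      by (rule bexI[OF _ imageI[of t]]) (use t d in auto)
  qed
qed (use d w zero in auto)

text \<open>
  A function holomorphic in \<open>(a, b) = (x + \<i>y, x - \<i>y)\<close> that vanishes for \<open>b = a\<close>-bar, that is for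
  real \<open>x\<close> and \<open>y\<close>, vanishes identically: continue first in \<open>y\<close>, then in \<open>x\<close>.
\<close>
lemma polarization_unique:
  fixes \<Phi> :: "complex ^ 1 \<Rightarrow> real"
  assumes P: "is_polarization \<Phi> 0 P" and Q: "is_polarization \<Phi> 0 Q"
  obtains d where "d > 0" "\<And>a b. norm a < d \<Longrightarrow> norm b < d \<Longrightarrow> P (a, b) = Q (a, b)"
proof -
  have v0: "vcnj (0::complex ^ 1) = 0" by (simp add: vcnj_def vec_eq_iff)
  have n1: "norm (vec z :: complex ^ 1) = cmod z" for z
    by (simp add: norm_vec_def L2_set_def)
  have ev: "\<forall>\<^sub>F q in nhds (0, 0). complex_differentiable_at P q \<and> complex_differentiable_at Q q"
    and ev2: "\<forall>\<^sub>F z in nhds 0. P (z, vcnj z) = Q (z, vcnj z)"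
    using P Q unfolding is_polarization_def v0
    by (auto elim: eventually_elim2)
  obtain e1 where e1: "e1 > 0"
    "\<And>q. norm q < e1 \<Longrightarrow> complex_differentiable_at P q \<and> complex_differentiable_at Q q"
    using ev unfolding eventually_nhds_metric by (auto simp flip: zero_prod_def)
  obtain e2 where e2: "e2 > 0" "\<And>z. norm z < e2 \<Longrightarrow> P (z, vcnj z) = Q (z, vcnj z)"
    using ev2 unfolding eventually_nhds_metric by auto
  \<comment> \<open>The norm of \<open>pt x y\<close> is at most
    \<open>2 * (cmod x + cmod y) < 4 * d\<close>; this explains the divisor 4.\<close>
  define d where "d = min e1 e2 / 4"
  have d: "d > 0" using e1 e2 by (simp add: d_def)
  define pt :: "complex \<Rightarrow> complex \<Rightarrow> (complex ^ 1) \<times> (complex ^ 1)"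
    where "pt x y = (vec (x + \<i> * y), vec (x - \<i> * y))" for x y
  define D where "D x y = P (pt x y) - Q (pt x y)" for x y
  have small: "norm (pt x y) < e1" if "cmod x < d" "cmod y < d" for x y
  proof -
    have "norm (pt x y) \<le> cmod (x + \<i> * y) + cmod (x - \<i> * y)"
      unfolding pt_def by (metis n1 norm_Pair_le)
    also have "\<dots> \<le> (cmod x + cmod y) + (cmod x + cmod y)"
      using norm_triangle_ineq[of x "\<i> * y"] norm_triangle_ineq4[of x "\<i> * y"]
      by (simp add: norm_mult)
    finally show ?thesis using that by (simp add: d_def)
  qed
  have line_y: "pt x y = (vec x, vec x) + y *\<^sub>C (vec \<i>, vec (- \<i>))" for x y
    by (simp add: pt_def scaleC_prod_def scaleC_vec_def scaleC_complex_def vec_eq_iff)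
  have line_x: "pt x y = (vec (\<i> * y), vec (- \<i> * y)) + x *\<^sub>C (vec 1, vec 1)" for x y
    by (simp add: pt_def scaleC_prod_def scaleC_vec_def scaleC_complex_def vec_eq_iff)
  have hol_y: "(\<lambda>y. D x y) holomorphic_on ball 0 d" if "cmod x < d" for x
    unfolding holomorphic_on_def
  proof
    fix y assume "y \<in> ball (0::complex) d"
    then have *: "complex_differentiable_at P ((vec x, vec x) + y *\<^sub>C (vec \<i>, vec (- \<i>)))"
      "complex_differentiable_at Q ((vec x, vec x) + y *\<^sub>C (vec \<i>, vec (- \<i>)))"
      using e1(2)[OF small[OF that, of y]] by (simp_all only: line_y mem_ball_0 simp_thms)
    show "D x field_differentiable at y within ball 0 d"
      unfolding D_def line_y
      by (rule field_differentiable_at_within, rule field_differentiable_diff)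
         (rule *[THEN field_differentiable_along_line])+
  qed
  have hol_x: "(\<lambda>x. D x y) holomorphic_on ball 0 d" if "cmod y < d" for y
    unfolding holomorphic_on_def
  proof
    fix x assume "x \<in> ball (0::complex) d"
    then have *: "complex_differentiable_at P ((vec (\<i> * y), vec (- \<i> * y)) + x *\<^sub>C (vec 1, vec 1))"
      "complex_differentiable_at Q ((vec (\<i> * y), vec (- \<i> * y)) + x *\<^sub>C (vec 1, vec 1))"
      using e1(2)[OF small[OF _ that, of x]] by (simp_all only: line_x mem_ball_0 simp_thms)
    show "(\<lambda>x. D x y) field_differentiable at x within ball 0 d"
      unfolding D_def line_x
      by (rule field_differentiable_at_within, rule field_differentiable_diff)
         (rule *[THEN field_differentiable_along_line])+
  qed
  have real: "D (of_real x) (of_real y) = 0" if "\<bar>x\<bar> < d" "\<bar>y\<bar> < d" for x y :: real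
  proof -
    let ?a = "complex_of_real x + \<i> * of_real y"
    have "cmod ?a \<le> \<bar>x\<bar> + \<bar>y\<bar>"
      using norm_triangle_ineq[of "complex_of_real x" "\<i> * of_real y"] by (simp add: norm_mult)
    also have "\<dots> < e2" using that by (auto simp: d_def)
    finally have "P (vec ?a, vcnj (vec ?a)) = Q (vec ?a, vcnj (vec ?a))"
      by (intro e2(2)) (simp add: n1)
    moreover have "vcnj (vec ?a) = (vec (of_real x - \<i> * of_real y) :: complex ^ 1)"
      by (simp add: vcnj_def vec_eq_iff)
    ultimately show ?thesis by (simp add: D_def pt_def)
  qed
  \<comment> \<open>First continuation: \<open>x\<close> stays real while \<open>y\<close> becomes
    complex. The next step then continues in \<open>x\<close> for each complex
    \<open>y\<close>.\<close>
  have "D (of_real x) y = 0" if "\<bar>x\<bar> < d" "cmod y < d" for x :: real and y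
    using holomorphic_zero_on_reals[OF d hol_y real that(2)] that(1) by simp
  then have D0: "D x y = 0" if "cmod x < d" "cmod y < d" for x y
    using holomorphic_zero_on_reals[OF d hol_x _ that(1)] that(2) by simp
  show thesis
  proof (rule that[OF d])
    fix a b :: "complex ^ 1" assume ab: "norm a < d" "norm b < d"
    define x y where "x = (a $ 1 + b $ 1) / 2" and "y = (a $ 1 - b $ 1) / (2 * \<i>)"
    have ab': "cmod (a $ 1) < d" "cmod (b $ 1) < d"
      using ab Finite_Cartesian_Product.norm_nth_le[of a 1] Finite_Cartesian_Product.norm_nth_le[of b 1]
      by linarith+
    then have "cmod x < d" "cmod y < d"
      unfolding x_def y_def norm_divide norm_mult
      using norm_triangle_ineq[of "a $ 1" "b $ 1"] norm_triangle_ineq4[of "a $ 1" "b $ 1"] by simp_all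
    moreover have "pt x y = (a, b)"
      by (simp add: pt_def x_def y_def vec_eq_iff forall_1 field_simps)
    ultimately show "P (a, b) = Q (a, b)" using D0[of x y] by (simp add: D_def)
  qed
qed

text \<open>Evaluates the definite description in \<open>calabi_coeff\<close>. Multi-indices over
  the one-element type are identified with natural numbers, and
  \<open>double_series_zero_coeff\<close>, applied to the difference of two expansions, gives
  uniqueness.\<close>

lemma calabi_coeff_one_variable:
  fixes \<Phi> :: "complex ^ 1 \<Rightarrow> real"
  assumes r: "r > 0"
    and C: "\<And>z. norm z < r \<Longrightarrow>
      ((\<lambda>(j, k). C j k * (z $ 1) ^ j * cnj (z $ 1) ^ k) has_sum (exp (diastasis \<Phi> 0 z) - 1)) UNIV"
  shows "calabi_coeff \<Phi> 0 = (\<lambda>j k. C (j 1) (k 1))"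
proof -
  have mono: "monomial j z = (z $ 1) ^ j 1" for j and z :: "complex ^ 1"
    by (simp add: monomial_def UNIV_1)
  have fun1: "(\<lambda>_. j 1) = j" for j :: "1 \<Rightarrow> nat"
    by (rule ext) (metis num1_eqI)
  have bij: "bij_betw (\<lambda>(j, k). (\<lambda>_. j, \<lambda>_. k)) (UNIV :: (nat \<times> nat) set)
      (UNIV :: ((1 \<Rightarrow> nat) \<times> (1 \<Rightarrow> nat)) set)"
    by (rule bij_betwI[where g = "\<lambda>(j, k). (j 1, k 1)"]) (auto simp: fun1)
  have reindex: "((\<lambda>(j, k). B j k * monomial j z * cnj (monomial k z)) has_sum s) UNIV \<longleftrightarrow>
      ((\<lambda>(j, k). B (\<lambda>_. j) (\<lambda>_. k) * (z $ 1) ^ j * cnj (z $ 1) ^ k) has_sum s) UNIV"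
    for B s and z :: "complex ^ 1"
    using has_sum_reindex_bij_betw[OF bij, of "\<lambda>(j, k). B j k * monomial j z * cnj (monomial k z)" s]
    by (simp add: mono case_prod_unfold)
  show ?thesis
    unfolding calabi_coeff_def
  proof (rule the_equality)
    show "\<forall>\<^sub>F z in nhds 0. ((\<lambda>(j, k). C (j 1) (k 1) * monomial j z * cnj (monomial k z))
        has_sum (exp (diastasis \<Phi> 0 (0 + z)) - 1)) UNIV"
      unfolding reindex eventually_nhds_metric using r C by auto
  next
    fix B
    assume "\<forall>\<^sub>F z in nhds 0. ((\<lambda>(j, k). B j k * monomial j z * cnj (monomial k z))
        has_sum (exp (diastasis \<Phi> 0 (0 + z)) - 1)) UNIV"
    then obtain r' where r': "r' > 0" "\<And>z. norm z < r' \<Longrightarrow>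
        ((\<lambda>(j, k). B (\<lambda>_. j) (\<lambda>_. k) * (z $ 1) ^ j * cnj (z $ 1) ^ k)
          has_sum (exp (diastasis \<Phi> 0 z) - 1)) UNIV"
      unfolding reindex eventually_nhds_metric by auto
    have "B (\<lambda>_. j) (\<lambda>_. k) - C j k = 0" for j k
    proof (rule double_series_zero_coeff[of "min r r'"])
      fix z assume "cmod z < min r r'"
      then have "norm (vec z :: complex ^ 1) < r" "norm (vec z :: complex ^ 1) < r'"
        by (simp_all add: norm_vec_def L2_set_def)
      from has_sum_minus[OF r'(2)[OF this(2)] C[OF this(1)]]
      show "((\<lambda>(j, k). (B (\<lambda>_. j) (\<lambda>_. k) - C j k) * z ^ j * cnj z ^ k) has_sum 0) UNIV"
        by (simp add: case_prod_unfold algebra_simps)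
    qed (use r r' in simp)
    then have "B (\<lambda>_. j 1) (\<lambda>_. k 1) = C (j 1) (k 1)" for j k :: "1 \<Rightarrow> nat"
      by simp
    then have "B j k = C (j 1) (k 1)" for j k
      by (simp only: fun1)
    then show "B = (\<lambda>j k. C (j 1) (k 1))"
      by (intro ext)
  qed
qed

section \<open>Radial potentials\<close>

text \<open>Substituting \<open>x = z * cnj z\<close> in the Taylor series of \<open>f\<close>
  produces only terms with equal exponents; all other entries are zeros that do not change the
  sum.\<close>

lemma radial_has_sum_diagonal:
  fixes f :: "complex \<Rightarrow> complex"
  assumes hol: "f holomorphic_on ball 0 \<rho>" and z: "(cmod z)\<^sup>2 < \<rho>"
  shows "((\<lambda>(j, k). (if j = k then fps_nth (fps_expansion f 0) j else 0) * z ^ j * cnj z ^ k)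
           has_sum f (of_real ((cmod z)\<^sup>2))) UNIV"
proof -
  define x where "x = complex_of_real ((cmod z)\<^sup>2)"
  \<comment> \<open>Convergence at \<open>\<sigma>\<close>, strictly beyond \<open>x\<close>, yields
    the absolute convergence at \<open>x\<close> on which the unordered sum rests.\<close>
  obtain \<sigma> where "(cmod z)\<^sup>2 < \<sigma>" "\<sigma> < \<rho>"
    using dense[OF z] by blast
  moreover from this(1) have "\<sigma> > 0" by (rule le_less_trans[OF zero_le_power2])
  ultimately have x: "cmod x < \<sigma>" "\<sigma> < \<rho>" "\<sigma> > 0"
    by (simp_all add: x_def del: of_real_power)
  have fps: "f has_fps_expansion fps_expansion f 0"
    using hol x by (intro has_fps_expansion_fps_expansion[of "ball 0 \<rho>"]) auto
  have sums: "(\<lambda>n. fps_nth (fps_expansion f 0) n * w ^ n) sums f w" if "cmod w < \<rho>" for w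
    by (rule has_fps_expansion_imp_sums_complex[OF fps, of "ereal \<rho>"]) (use hol that in auto)
  have "summable (\<lambda>n. norm (fps_nth (fps_expansion f 0) n * x ^ n))"
    by (rule powser_insidea[OF sums_summable[OF sums[of "of_real \<sigma>"]]]) (use x in auto)
  moreover have "(\<lambda>n. fps_nth (fps_expansion f 0) n * x ^ n) sums f x"
    by (rule sums) (use x in simp)
  ultimately have "((\<lambda>n. fps_nth (fps_expansion f 0) n * x ^ n) has_sum f x) UNIV"
    by (rule norm_summable_imp_has_sum)
  moreover have "x ^ n = z ^ n * cnj z ^ n" for n
    unfolding x_def complex_norm_square power_mult_distrib ..
  ultimately have "(((\<lambda>(j, k). (if j = k then fps_nth (fps_expansion f 0) j else 0) * z ^ j * cnj z ^ k)
      \<circ> (\<lambda>n. (n, n))) has_sum f x) UNIV"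
    by (simp add: o_def mult.assoc)
  then have "((\<lambda>(j, k). (if j = k then fps_nth (fps_expansion f 0) j else 0) * z ^ j * cnj z ^ k)
      has_sum f x) (range (\<lambda>n. (n, n)))"
    by (subst has_sum_reindex) (auto simp: inj_on_def)
  then show ?thesis
    unfolding x_def by (rule has_sum_cong_neutral[THEN iffD1, rotated -1]) auto
qed

text \<open>Since |z|^2 is \<open>z * cnj z\<close>, polarizing means replacing \<open>cnj z\<close>
  by an independent variable \<open>w\<close>.\<close>

lemma radial_polarization:
  fixes \<Phi> :: "complex ^ 1 \<Rightarrow> real"
  assumes \<rho>: "\<rho> > 0" and hol: "T holomorphic_on ball 0 \<rho>"
    and \<Phi>: "\<And>z. (cmod (z $ 1))\<^sup>2 < \<rho> \<Longrightarrow> T (of_real ((cmod (z $ 1))\<^sup>2)) = of_real (\<Phi> z)"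
  shows "is_polarization \<Phi> 0 (\<lambda>(z, w). T (z $ 1 * w $ 1))"
  unfolding is_polarization_def
proof
  have v0: "vcnj (0::complex ^ 1) = 0" by (simp add: vcnj_def vec_eq_iff)
  let ?U = "{q :: (complex ^ 1) \<times> (complex ^ 1). cmod (fst q $ 1 * snd q $ 1) < \<rho>}"
  have "open ?U"
    by (intro open_Collect_less continuous_intros)
  then have "\<forall>\<^sub>F q in nhds (0 :: complex ^ 1, vcnj 0). q \<in> ?U"
    by (rule eventually_nhds_in_open) (use \<rho> in \<open>simp add: v0\<close>)
  moreover have "complex_differentiable_at (\<lambda>(z, w). T (z $ 1 * w $ 1)) q" if "q \<in> ?U" for q
  proof -
    have "(T has_field_derivative deriv T (fst q $ 1 * snd q $ 1)) (at (fst q $ 1 * snd q $ 1))"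
      using hol that by (intro holomorphic_derivI[of _ "ball 0 \<rho>"]) auto
    moreover have "((\<lambda>p. fst p $ 1 * snd p $ 1) has_derivative
        (\<lambda>p. fst q $ 1 * snd p $ 1 + fst p $ 1 * snd q $ 1)) (at q)"
      by (auto intro!: derivative_eq_intros bounded_linear.has_derivative[OF bounded_linear_vec_nth])
    ultimately have "((\<lambda>p. T (fst p $ 1 * snd p $ 1)) has_derivative
        (\<lambda>p. deriv T (fst q $ 1 * snd q $ 1) * (fst q $ 1 * snd p $ 1 + fst p $ 1 * snd q $ 1))) (at q)"
      unfolding has_field_derivative_def by (rule has_derivative_compose[rotated])
    then show "complex_differentiable_at (\<lambda>(z, w). T (z $ 1 * w $ 1)) q"
      unfolding complex_differentiable_at_def case_prod_unfold
      by (intro exI conjI)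
         (auto simp: scaleC_prod_def scaleC_vec_def scaleC_complex_def algebra_simps)
  qed
  ultimately show "\<forall>\<^sub>F q in nhds (0 :: complex ^ 1, vcnj (0 :: complex ^ 1)). complex_differentiable_at (\<lambda>(z, w). T (z $ 1 * w $ 1)) q"
    by (rule eventually_mono)
  have "open {z :: complex ^ 1. (cmod (z $ 1))\<^sup>2 < \<rho>}"
    by (intro open_Collect_less continuous_intros)
  then have "\<forall>\<^sub>F z in nhds 0. z \<in> {z :: complex ^ 1. (cmod (z $ 1))\<^sup>2 < \<rho>}"
    by (rule eventually_nhds_in_open) (use \<rho> in simp)
  then show "\<forall>\<^sub>F z in nhds 0. (case (z, vcnj z) of (z, w) \<Rightarrow> T (z $ 1 * w $ 1)) = of_real (\<Phi> z)"
  proof (rule eventually_mono)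
    fix z assume "z \<in> {z :: complex ^ 1. (cmod (z $ 1))\<^sup>2 < \<rho>}"
    then show "(case (z, vcnj z) of (z, w) \<Rightarrow> T (z $ 1 * w $ 1)) = of_real (\<Phi> z)"
      using \<Phi>[of z] by (simp add: vcnj_def complex_norm_square del: of_real_power)
  qed
qed

text \<open>The diastasis is defined through a chosen polarization, which
  \<open>polarization_unique\<close> replaces near 0 by the explicit one. As \<open>T 0 = 0\<close>,
  the three terms with an argument at the centre vanish, and the diastasis is the potential
  itself.\<close>

lemma radial_calabi_coeff:
  fixes \<Phi> :: "complex ^ 1 \<Rightarrow> real"
  assumes \<rho>: "\<rho> > 0" and hol: "T holomorphic_on ball 0 \<rho>" and T0: "T 0 = 0"
    and \<Phi>: "\<And>z. (cmod (z $ 1))\<^sup>2 < \<rho> \<Longrightarrow> T (of_real ((cmod (z $ 1))\<^sup>2)) = of_real (\<Phi> z)"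
    and n: "n > 0"
  shows "calabi_coeff \<Phi> 0 (\<lambda>_. n) (\<lambda>_. n) = fps_nth (fps_expansion (\<lambda>x. exp (T x)) 0) n"
proof -
  let ?P0 = "\<lambda>(z, w). T ((z :: complex ^ 1) $ 1 * (w :: complex ^ 1) $ 1)"
  let ?A = "fps_expansion (\<lambda>x. exp (T x)) 0"
  have v0: "vcnj (0::complex ^ 1) = 0" by (simp add: vcnj_def vec_eq_iff)
  have nv: "norm (vcnj z) = norm z" for z :: "complex ^ 1"
    by (simp add: norm_vec_def vcnj_def)
  have P0: "is_polarization \<Phi> 0 ?P0"
    using \<rho> hol \<Phi> by (rule radial_polarization)
  define P where "P = (SOME P. is_polarization \<Phi> 0 P)"
  have "is_polarization \<Phi> 0 P"
    unfolding P_def using P0 by (rule someI[of "is_polarization \<Phi> 0"])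
  then obtain d where d: "d > 0" "\<And>a b. norm a < d \<Longrightarrow> norm b < d \<Longrightarrow> P (a, b) = ?P0 (a, b)"
    using polarization_unique[OF _ P0] by metis
  define r where "r = min d (sqrt \<rho>)"
  have r: "r > 0" using d \<rho> by (simp add: r_def)
  have dia: "diastasis \<Phi> 0 z = T (of_real ((cmod (z $ 1))\<^sup>2))" if "norm z < r" for z
  proof -
    have "P (z, vcnj z) = T (z $ 1 * cnj (z $ 1))" "P (0, vcnj 0) = 0" "P (z, vcnj 0) = 0" "P (0, vcnj z) = 0"
      using d that by (simp_all add: v0 nv r_def T0) (simp_all add: vcnj_def)
    then show ?thesis
      by (simp add: diastasis_def P_def[symmetric] complex_norm_square del: of_real_power)
  qed
  \<comment> \<open>Subtracting 1 from the exponential affects only the entry at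
    \<open>(0, 0)\<close>; this is why \<open>n > 0\<close> is assumed.\<close>
  define C where "C j k = (if j = k then fps_nth ?A j else 0) - (if j = 0 \<and> k = 0 then 1 else 0)" for j k :: nat
  have "calabi_coeff \<Phi> 0 = (\<lambda>j k. C (j 1) (k 1))"
  proof (rule calabi_coeff_one_variable[OF r])
    fix z :: "complex ^ 1" assume z: "norm z < r"
    have "cmod (z $ 1) < sqrt \<rho>"
      using z Finite_Cartesian_Product.norm_nth_le[of z 1] by (simp add: r_def)
    then have "(cmod (z $ 1))\<^sup>2 < \<rho>"
      using \<rho> by (metis norm_ge_zero real_less_rsqrt real_sqrt_less_iff real_sqrt_abs abs_of_nonneg)
    then have "((\<lambda>(j, k). (if j = k then fps_nth ?A j else 0) * (z $ 1) ^ j * cnj (z $ 1) ^ k)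
        has_sum exp (diastasis \<Phi> 0 z)) UNIV"
      unfolding dia[OF z] using hol
      by (intro radial_has_sum_diagonal[of "\<lambda>x. exp (T x)" \<rho>] holomorphic_intros) auto
    moreover have "((\<lambda>(j, k). (if j = 0 \<and> k = 0 then 1 else 0) * (z $ 1) ^ j * cnj (z $ 1) ^ k)
        has_sum 1) UNIV"
      by (rule has_sum_finite_neutralI[of "{(0, 0)}"]) (auto split: if_splits)
    ultimately show "((\<lambda>(j, k). C j k * (z $ 1) ^ j * cnj (z $ 1) ^ k)
        has_sum (exp (diastasis \<Phi> 0 z) - 1)) UNIV"
      by (rule has_sum_cong[THEN iffD1, OF _ has_sum_minus, rotated])
         (auto simp: C_def algebra_simps)
  qed
  then show ?thesis using n by (simp add: C_def)
qed

lemma axis_not_one_resolvable: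
  fixes m \<alpha> :: real
  assumes "m > 0" "\<alpha> > 0"
  shows "\<not> one_resolvable (\<lambda>z. \<alpha> * taub_nut_potential m (axis_incl z)) 0 N"
proof
  assume "one_resolvable (\<lambda>z. \<alpha> * taub_nut_potential m (axis_incl z)) 0 N"
  then have psd: "hermitian_psd (calabi_coeff (\<lambda>z. \<alpha> * taub_nut_potential m (axis_incl z)) 0)"
    by (simp add: one_resolvable_def)
  obtain T \<rho> n where T: "\<rho> > 0" "T holomorphic_on ball 0 \<rho>" "T 0 = 0"
    "\<And>z. (cmod (z $ 1))\<^sup>2 < \<rho> \<Longrightarrow>
       T (of_real ((cmod (z $ 1))\<^sup>2)) = of_real (\<alpha> * taub_nut_potential m (axis_incl z))"
    and n: "n > 0" "Re (fps_nth (fps_expansion (\<lambda>x. exp (T x)) 0) n) < 0"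
    using taub_nut_axis_holomorphic[OF assms] by metis
  have "Re (calabi_coeff (\<lambda>z. \<alpha> * taub_nut_potential m (axis_incl z)) 0 (\<lambda>_. n) (\<lambda>_. n)) < 0"
    using n radial_calabi_coeff[OF T n(1)] by simp
  \<comment> \<open>Testing semidefiniteness on a single index with coefficient 1 extracts the
    diagonal entry.\<close>
  moreover have "finite {\<lambda>_::1. n}" by simp
  then have "0 \<le> Re (\<Sum>j\<in>{\<lambda>_. n}. \<Sum>k\<in>{\<lambda>_. n}.
      calabi_coeff (\<lambda>z. \<alpha> * taub_nut_potential m (axis_incl z)) 0 j k * 1 * cnj 1)"
    using psd unfolding hermitian_psd_def by (elim conjE allE) (erule mp)
  ultimately show False by simp
qed

section \<open>Metrics along a complex line\<close>

lemma bounded_linear_coord: "bounded_linear (\<lambda>x. coord x j)"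
proof (rule bounded_linear_intro[where K = 1])
  show "coord (x + y) j = coord x j + coord y j" for x y by (simp add: plus_ell2.rep_eq)
  show "coord (r *\<^sub>R x) j = r *\<^sub>R coord x j" for r x
    by (simp add: scaleR_ell2.rep_eq scaleR_conv_of_real)
  fix x
  have "(\<Sum>i\<in>{j}. (cmod (coord x i))\<^sup>2) \<le> (\<Sum>i. (cmod (coord x i))\<^sup>2)"
    by (rule sum_le_suminf[OF summable_coord]) auto
  then have "(cmod (coord x j))\<^sup>2 \<le> (norm x)\<^sup>2" by (simp add: norm_ell2_sq)
  then show "norm (coord x j) \<le> norm x * 1" by (simp add: power2_le_iff_abs_le)
qed

text \<open>The Hermitian product, linear in the first argument and conjugate linear in the second.
  The imaginary part comes from the real inner product because Re (x * cnj (i * y)) = Im (x * cnj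
  y).\<close>

definition cinner :: "ell2 \<Rightarrow> ell2 \<Rightarrow> complex" where
  "cinner x y = Complex (x \<bullet> y) (x \<bullet> (\<i> *\<^sub>C y))"

lemma Re_cinner: "Re (cinner x y) = x \<bullet> y"
  by (simp add: cinner_def)

lemma cinner_sums: "(\<lambda>j. coord x j * cnj (coord y j)) sums cinner x y"
proof -
  have "(\<lambda>j. coord x j \<bullet> coord y j) sums (x \<bullet> y)" for y
    unfolding inner_ell2_def by (rule summable_sums[OF summable_inner_coord])
  from this[of y] this[of "\<i> *\<^sub>C y"] show ?thesis
    by (simp add: sums_complex_iff cinner_def scaleC_ell2.rep_eq inner_complex_def algebra_simps)
qed

lemma cinner_commute: "cnj (cinner x y) = cinner y x"
proof -
  have "(\<lambda>j. coord y j * cnj (coord x j)) sums cnj (cinner x y)"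
    using sums_cnj[THEN iffD2, OF cinner_sums, of x y] by (simp add: mult.commute)
  then show ?thesis using cinner_sums sums_unique2 by blast
qed

lemma cinner_scaleC_left: "cinner (c *\<^sub>C x) y = c * cinner x y"
proof -
  have "(\<lambda>j. coord (c *\<^sub>C x) j * cnj (coord y j)) sums (c * cinner x y)"
    using sums_mult[OF cinner_sums, of c x y] by (simp add: scaleC_ell2.rep_eq mult.assoc)
  then show ?thesis using cinner_sums sums_unique2 by blast
qed

text \<open>Along a real line \<open>1 + (norm x)\<^sup>2\<close> is a quadratic polynomial in
  \<open>t\<close>, so the second derivatives are explicit. Adding the directions \<open>X\<close>
  and \<open>\<i> *\<^sub>C X\<close> combines two squared real inner products into the squared
  modulus of \<open>cinner\<close>.\<close>

lemma fubini_study_metric: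
  "kahler_metric fubini_study_potential w X X
     = (norm X)\<^sup>2 / (1 + (norm w)\<^sup>2) - (cmod (cinner X w))\<^sup>2 / (1 + (norm w)\<^sup>2)\<^sup>2"
proof -
  have expand: "(norm (x + t *\<^sub>R Y))\<^sup>2 = (norm x)\<^sup>2 + 2 * t * (x \<bullet> Y) + t\<^sup>2 * (norm Y)\<^sup>2"
    for x Y :: ell2 and t
    unfolding power2_norm_eq_inner
    by (simp add: inner_add_left inner_add_right inner_commute[of Y x] power2_eq_square algebra_simps
        del: dot_square_norm)
  have pos: "1 + (norm x)\<^sup>2 > 0" for x :: ell2
    using zero_le_power2[of "norm x"] by linarith
  have d1: "dir_deriv Y fubini_study_potential = (\<lambda>x. 2 * (x \<bullet> Y) / (1 + (norm x)\<^sup>2))" for Y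
  proof
    fix x
    have "((\<lambda>t. fubini_study_potential (x + t *\<^sub>R Y)) has_real_derivative
        2 * (x \<bullet> Y) / (1 + (norm x)\<^sup>2)) (at 0)"
      unfolding fubini_study_potential_def expand using pos[of x]
      by (auto intro!: derivative_eq_intros)
    then show "dir_deriv Y fubini_study_potential x = 2 * (x \<bullet> Y) / (1 + (norm x)\<^sup>2)"
      unfolding dir_deriv_def by (rule DERIV_imp_deriv)
  qed
  have d2: "dir_deriv Y (dir_deriv Y fubini_study_potential) w
      = 2 * (norm Y)\<^sup>2 / (1 + (norm w)\<^sup>2) - 4 * (w \<bullet> Y)\<^sup>2 / (1 + (norm w)\<^sup>2)\<^sup>2" for Y
  proof -
    \<comment> \<open>Used with \<open>D = 1 + (norm w)\<^sup>2\<close>,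
      \<open>a = w \<bullet> Y\<close> and \<open>b = (norm Y)\<^sup>2\<close>.\<close>
    have quot: "((\<lambda>t. 2 * (a + t * b) / (D + 2 * t * a + t\<^sup>2 * b)) has_real_derivative
        2 * b / D - 4 * a\<^sup>2 / D\<^sup>2) (at 0)" if "D > 0" for a b D :: real
      using that by (auto intro!: derivative_eq_intros simp: field_simps power2_eq_square)
    have "((\<lambda>t. 2 * ((w + t *\<^sub>R Y) \<bullet> Y) / (1 + (norm (w + t *\<^sub>R Y))\<^sup>2)) has_real_derivative
        2 * (norm Y)\<^sup>2 / (1 + (norm w)\<^sup>2) - 4 * (w \<bullet> Y)\<^sup>2 / (1 + (norm w)\<^sup>2)\<^sup>2) (at 0)"
      using quot[OF pos, of "w \<bullet> Y" "(norm Y)\<^sup>2" w]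
      unfolding expand inner_add_left inner_scaleR_left power2_norm_eq_inner[of Y, symmetric]
      by (simp only: add.assoc)
    then show ?thesis unfolding d1 dir_deriv_def by (rule DERIV_imp_deriv)
  qed
  have "cmod (cinner X w) = cmod (cinner w X)"
    by (metis cinner_commute complex_mod_cnj)
  then have "(cmod (cinner X w))\<^sup>2 = (w \<bullet> X)\<^sup>2 + (w \<bullet> (\<i> *\<^sub>C X))\<^sup>2"
    by (simp add: cmod_power2 cinner_def)
  moreover have "(2 * a / D - 4 * s / D\<^sup>2 + (2 * a / D - 4 * t / D\<^sup>2)) / 4 = a / D - (s + t) / D\<^sup>2"
    for a s t D :: real
    by (simp add: add_divide_distrib diff_divide_distrib)
  ultimately show ?thesis
    by (simp only: kahler_metric_def d2 norm_scaleC norm_ii mult_1_left)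
qed

text \<open>The left side is a quarter of the Laplacian of \<open>\<psi> (|z|^2)\<close>, that is,
  the derivative of \<open>x * \<psi>1 x\<close> at \<open>x = |z|^2\<close>.\<close>

lemma radial_metric:
  fixes \<phi> :: "complex ^ 1 \<Rightarrow> real"
  assumes \<phi>: "\<And>z. (cmod (z $ 1))\<^sup>2 < \<rho> \<Longrightarrow> \<phi> z = \<psi> ((cmod (z $ 1))\<^sup>2)"
    and \<psi>1: "\<And>x. 0 \<le> x \<Longrightarrow> x < \<rho> \<Longrightarrow> (\<psi> has_real_derivative \<psi>1 x) (at x)"
    and \<psi>2: "\<And>x. 0 \<le> x \<Longrightarrow> x < \<rho> \<Longrightarrow> (\<psi>1 has_real_derivative \<psi>2 x) (at x)"
    and z: "(cmod z)\<^sup>2 < \<rho>"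
  shows "kahler_metric \<phi> (vec z) (vec 1) (vec 1) = \<psi>1 ((cmod z)\<^sup>2) + (cmod z)\<^sup>2 * \<psi>2 ((cmod z)\<^sup>2)"
proof -
  have expand: "(cmod (w + of_real t * y))\<^sup>2 = (cmod w)\<^sup>2 + 2 * t * Re (w * cnj y) + t\<^sup>2 * (cmod y)\<^sup>2"
    for w y t
    unfolding cmod_power2 by (simp add: power2_eq_square algebra_simps)
  have line: "(vec w + t *\<^sub>R vec y :: complex ^ 1) = vec (w + of_real t * y)" for w y t
    unfolding vec_eq_iff by simp (simp add: scaleR_conv_of_real)
  have ev: "\<forall>\<^sub>F t in nhds 0. (cmod (w + of_real t * y))\<^sup>2 < \<rho>" if "(cmod w)\<^sup>2 < \<rho>" for w y
  proof -
    have "open {t :: real. (cmod (w + of_real t * y))\<^sup>2 < \<rho>}"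
      by (intro open_Collect_less continuous_intros)
    from eventually_nhds_in_open[OF this, of 0] show ?thesis using that by simp
  qed
  have norm_sq: "((\<lambda>t. (cmod (w + of_real t * y))\<^sup>2) has_real_derivative 2 * Re (w * cnj y)) (at 0)" for w y
    unfolding expand by (auto intro!: derivative_eq_intros)
  have d1: "dir_deriv (vec y) \<phi> (vec w) = 2 * Re (w * cnj y) * \<psi>1 ((cmod w)\<^sup>2)"
    if w: "(cmod w)\<^sup>2 < \<rho>" for w y
  proof -
    have "((\<lambda>t. \<psi> ((cmod (w + of_real t * y))\<^sup>2)) has_real_derivative
        \<psi>1 ((cmod w)\<^sup>2) * (2 * Re (w * cnj y))) (at 0)"
      using DERIV_chain2[OF _ norm_sq, of \<psi> "\<psi>1 ((cmod w)\<^sup>2)" w y] \<psi>1[OF _ w] by simp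
    note D = this
    have E: "\<forall>\<^sub>F t in nhds 0. \<phi> (vec w + t *\<^sub>R vec y) = \<psi> ((cmod (w + of_real t * y))\<^sup>2)"
      using ev[OF w, of y] by (rule eventually_mono) (simp add: line \<phi>)
    have "((\<lambda>t. \<phi> (vec w + t *\<^sub>R vec y)) has_real_derivative
        \<psi>1 ((cmod w)\<^sup>2) * (2 * Re (w * cnj y))) (at 0)"
      by (rule DERIV_cong_ev[OF refl E refl, THEN iffD2, OF D])
    then have "dir_deriv (vec y) \<phi> (vec w) = \<psi>1 ((cmod w)\<^sup>2) * (2 * Re (w * cnj y))"
      unfolding dir_deriv_def by (rule DERIV_imp_deriv)
    then show ?thesis by (simp only: mult.commute)
  qed
  have d2: "dir_deriv (vec y) (dir_deriv (vec y) \<phi>) (vec z)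
      = 2 * (cmod y)\<^sup>2 * \<psi>1 ((cmod z)\<^sup>2) + 4 * (Re (z * cnj y))\<^sup>2 * \<psi>2 ((cmod z)\<^sup>2)" for y
  proof -
    have *: "((\<lambda>t. \<psi>1 ((cmod (z + of_real t * y))\<^sup>2)) has_real_derivative
        \<psi>2 ((cmod z)\<^sup>2) * (2 * Re (z * cnj y))) (at 0)"
      using DERIV_chain2[OF _ norm_sq, of \<psi>1 "\<psi>2 ((cmod z)\<^sup>2)" z y] \<psi>2[OF _ z] by simp
    have "((\<lambda>t. 2 * Re ((z + of_real t * y) * cnj y)) has_real_derivative 2 * (cmod y)\<^sup>2) (at 0)"
    proof -
      have "2 * Re ((z + of_real t * y) * cnj y) = 2 * Re (z * cnj y) + 2 * t * (cmod y)\<^sup>2" for t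
        unfolding cmod_power2 by (simp add: power2_eq_square algebra_simps)
      then show ?thesis by (auto intro!: derivative_eq_intros)
    qed
    from DERIV_mult[OF this *]
    have "((\<lambda>t. 2 * Re ((z + of_real t * y) * cnj y) * \<psi>1 ((cmod (z + of_real t * y))\<^sup>2))
        has_real_derivative
        2 * (cmod y)\<^sup>2 * \<psi>1 ((cmod z)\<^sup>2) + 4 * (Re (z * cnj y))\<^sup>2 * \<psi>2 ((cmod z)\<^sup>2)) (at 0)"
      by (rule DERIV_cong) (simp add: power2_eq_square algebra_simps)
    note D = this
    have E: "\<forall>\<^sub>F t in nhds 0. dir_deriv (vec y) \<phi> (vec z + t *\<^sub>R vec y)
        = 2 * Re ((z + of_real t * y) * cnj y) * \<psi>1 ((cmod (z + of_real t * y))\<^sup>2)"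
      using ev[OF z, of y] by (rule eventually_mono, unfold line, intro d1)
    have "((\<lambda>t. dir_deriv (vec y) \<phi> (vec z + t *\<^sub>R vec y)) has_real_derivative
        2 * (cmod y)\<^sup>2 * \<psi>1 ((cmod z)\<^sup>2) + 4 * (Re (z * cnj y))\<^sup>2 * \<psi>2 ((cmod z)\<^sup>2)) (at 0)"
      by (rule DERIV_cong_ev[OF refl E refl, THEN iffD2, OF D])
    then show ?thesis unfolding dir_deriv_def by (rule DERIV_imp_deriv)
  qed
  have "\<i> *\<^sub>C vec 1 = (vec \<i> :: complex ^ 1)"
    by (simp add: vec_eq_iff scaleC_vec_def scaleC_complex_def)
  then show ?thesis
    unfolding kahler_metric_def by (simp only: d2) (simp add: cmod_power2 algebra_simps)
qed

text \<open>Some homogeneous coordinate \<open>k\<close> of \<open>F p\<close> is nonzero, and the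
  image stays in that affine chart near \<open>p\<close>. \<open>h\<close> is the immersion in this
  chart along the line through \<open>p\<close> in direction \<open>v\<close>, and \<open>H\<close>
  is its complex derivative.\<close>

lemma kahler_immersion_along_line:
  fixes F :: "'a::complex_normed_vector \<Rightarrow> ell2 set"
  assumes F: "kahler_immersion g N F"
  obtains e h H where "e > 0"
    "\<And>z. cmod z < e \<Longrightarrow> (h has_derivative (\<lambda>v. v *\<^sub>C H z)) (at z)"
    "\<And>z. cmod z < e \<Longrightarrow>
       kahler_metric fubini_study_potential (h z) (H z) (H z) = g (p + z *\<^sub>C v) v v"
proof -
  have hol: "holomorphic_into_CP N F" using F by (simp add: kahler_immersion_def)
  then have "F p \<in> CP N" unfolding holomorphic_into_CP_def by blast
  then obtain x where x: "F p = complex_line x" "x \<noteq> 0" unfolding CP_def by blast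
  obtain k where k: "coord x k \<noteq> 0"
    using x(2) ell2_eqI[of x 0] by (auto simp: zero_ell2.rep_eq)
  have "x \<in> complex_line x"
    unfolding complex_line_def using scaleC_of_real[of 1 x] by (metis rangeI of_real_1 scaleR_one)
  then have Fp: "F p \<in> affine_domain k"
    using x k unfolding affine_domain_def by blast
  then have "\<forall>\<^sub>F q in nhds p. F q \<in> affine_domain k"
    using hol unfolding holomorphic_into_CP_def by blast
  then obtain d where d: "d > 0" "\<And>q. dist q p < d \<Longrightarrow> F q \<in> affine_domain k"
    unfolding eventually_nhds_metric by blast
  define f where "f = (\<lambda>q. affine_chart k (F q))"
  \<comment> \<open>The summand 1 keeps the quotient meaningful for \<open>v = 0\<close>.\<close>
  define e where "e = d / (norm v + 1)"
  have e: "e > 0" using d by (simp add: e_def add_nonneg_pos)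
  have in_dom: "F (p + z *\<^sub>C v) \<in> affine_domain k" if "cmod z < e" for z
  proof (rule d(2))
    have "cmod z * norm v \<le> cmod z * (norm v + 1)" by (intro mult_left_mono) auto
    also have "\<dots> < d" using that by (simp add: e_def pos_less_divide_eq add_nonneg_pos)
    finally show "dist (p + z *\<^sub>C v) p < d" by (simp add: dist_norm norm_scaleC)
  qed
  define H where "H z = frechet_derivative f (at (p + z *\<^sub>C v)) v" for z
  show thesis
  proof (rule that[OF e])
    fix z assume z: "cmod z < e"
    have "complex_differentiable_at f (p + z *\<^sub>C v)"
      using hol in_dom[OF z] unfolding holomorphic_into_CP_def f_def by blast
    then obtain f' where f': "(f has_derivative f') (at (p + z *\<^sub>C v))" "\<And>c u. f' (c *\<^sub>C u) = c *\<^sub>C f' u"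
      unfolding complex_differentiable_at_def by blast
    have H: "H z = f' v" unfolding H_def using frechet_derivative_at[OF f'(1)] by simp
    have "((\<lambda>s. p + s *\<^sub>C v) has_derivative (\<lambda>s. s *\<^sub>C v)) (at z)"
      using has_derivative_add[OF has_derivative_const bounded_linear_imp_has_derivative[OF bounded_linear_scaleC_left]]
      by simp
    from has_derivative_compose[OF this f'(1)]
    show "((\<lambda>s. f (p + s *\<^sub>C v)) has_derivative (\<lambda>s. s *\<^sub>C H z)) (at z)"
      by (simp add: f'(2) H)
    show "kahler_metric fubini_study_potential (f (p + z *\<^sub>C v)) (H z) (H z) = g (p + z *\<^sub>C v) v v"
      using F in_dom[OF z] unfolding kahler_immersion_def f_def H_def Let_def by blast
  qed
qed

section \<open>Holomorphic curves in the Hilbert space\<close>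

text \<open>
  The \<open>\<ell>\<^sup>2\<close> sum is bounded on the circle, so integrating Cauchy's formula for \<open>(f j)\<^sup>2\<close> bounds each
  \<open>f j\<close> uniformly by a square summable sequence.
\<close>
lemma square_summable_uniform_bound:
  fixes f :: "nat \<Rightarrow> complex \<Rightarrow> complex"
  assumes R: "0 < R" "R < e" and hol: "\<And>j. f j holomorphic_on ball 0 e"
    and K: "\<And>z n. cmod z = R \<Longrightarrow> (\<Sum>j<n. (cmod (f j z))\<^sup>2) \<le> K"
  obtains \<mu> where "summable (\<lambda>j. (\<mu> j)\<^sup>2)" "\<And>j. 0 \<le> \<mu> j"
    "\<And>j z. cmod z \<le> R / 2 \<Longrightarrow> cmod (f j z) \<le> \<mu> j"
proof -
  define \<gamma> where "\<gamma> = circlepath 0 R"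
  have \<gamma>: "cmod (\<gamma> t) = R" for t
    using R by (simp add: \<gamma>_def circlepath norm_mult)
  have hol': "f j holomorphic_on cball 0 R" for j
    using hol R by (rule_tac holomorphic_on_subset[of _ "ball 0 e"]) auto
  have cont\<gamma>: "continuous_on {0..1} \<gamma>"
    unfolding \<gamma>_def by (rule path_circlepath[unfolded path_def])
  have cont: "continuous_on {0..1} (\<lambda>t. (cmod (f j (\<gamma> t)))\<^sup>2)" for j
    by (intro continuous_intros continuous_on_compose2[OF holomorphic_on_imp_continuous_on[OF hol'] cont\<gamma>])
       (auto simp: \<gamma>)
  then have int: "(\<lambda>t. (cmod (f j (\<gamma> t)))\<^sup>2) integrable_on {0..1}" for j
    by (rule integrable_continuous_interval)
  \<comment> \<open>On the circle \<open>cmod (\<gamma> t - z) \<ge> R / 2\<close> and the speed is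
    \<open>2 * pi * R\<close>, so the Cauchy integrand is at most \<open>4 * pi\<close> times the
    squared modulus. Division by \<open>2 * pi\<close> leaves the factor 2.\<close>
  define M where "M j = 2 * integral {0..1} (\<lambda>t. (cmod (f j (\<gamma> t)))\<^sup>2)" for j
  have M0: "0 \<le> M j" for j
    unfolding M_def by (simp add: integral_nonneg int)
  have summable: "summable M"
  proof (rule summableI_nonneg_bounded)
    fix n
    have "(\<Sum>j<n. M j) = 2 * integral {0..1} (\<lambda>t. \<Sum>j<n. (cmod (f j (\<gamma> t)))\<^sup>2)"
      unfolding M_def by (simp add: integral_sum int sum_distrib_left)
    also have "integral {0..1} (\<lambda>t. \<Sum>j<n. (cmod (f j (\<gamma> t)))\<^sup>2) \<le> integral {0..1} (\<lambda>_::real. K)"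
      by (intro integral_le integrable_sum int) (auto intro: K \<gamma>)
    finally show "(\<Sum>j<n. M j) \<le> 2 * K" by simp
  qed (rule M0)
  have bound: "(cmod (f j z))\<^sup>2 \<le> M j" if z: "cmod z \<le> R / 2" for j z
  proof -
    have "(\<lambda>u. (f j u)\<^sup>2) holomorphic_on cball 0 R" by (intro holomorphic_intros hol')
    then have "((\<lambda>u. (f j u)\<^sup>2 / (u - z)) has_contour_integral 2 * of_real pi * \<i> * (f j z)\<^sup>2) \<gamma>"
      unfolding \<gamma>_def by (rule Cauchy_integral_circlepath_simple) (use z R in auto)
    then have hi: "((\<lambda>t. (f j (\<gamma> t))\<^sup>2 / (\<gamma> t - z) * vector_derivative \<gamma> (at t within {0..1}))
        has_integral 2 * of_real pi * \<i> * (f j z)\<^sup>2) {0..1}"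
      unfolding has_contour_integral_def .
    have le: "norm ((f j (\<gamma> t))\<^sup>2 / (\<gamma> t - z) * vector_derivative \<gamma> (at t within {0..1}))
        \<le> 4 * pi * (cmod (f j (\<gamma> t)))\<^sup>2" if t: "t \<in> {0..1}" for t
    proof -
      have "vector_derivative \<gamma> (at t within {0..1}) = 2 * pi * \<i> * R * exp (2 * of_real pi * \<i> * t)"
        unfolding \<gamma>_def using t by (intro vector_derivative_circlepath01) auto
      then have "cmod (vector_derivative \<gamma> (at t within {0..1})) = 2 * pi * R"
        using R by (simp add: norm_mult)
      moreover have "R / 2 \<le> cmod (\<gamma> t - z)"
        using norm_triangle_ineq2[of "\<gamma> t" z] z \<gamma>[of t] by simp
      then have "(cmod (f j (\<gamma> t)))\<^sup>2 / cmod (\<gamma> t - z) * (2 * pi * R)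
          \<le> (cmod (f j (\<gamma> t)))\<^sup>2 / (R / 2) * (2 * pi * R)"
        using R by (intro mult_right_mono divide_left_mono mult_pos_pos) auto
      ultimately show ?thesis using R by (simp add: norm_mult norm_divide norm_power mult_ac)
    qed
    have "cmod (2 * of_real pi * \<i> * (f j z)\<^sup>2) \<le> integral {0..1} (\<lambda>t. 4 * pi * (cmod (f j (\<gamma> t)))\<^sup>2)"
      unfolding integral_unique[OF hi, symmetric]
      by (rule integral_norm_bound_integral[OF has_integral_integrable[OF hi] _ le])
         (auto intro!: integrable_on_mult_right int)
    also have "\<dots> = 2 * pi * M j" by (simp add: M_def)
    finally show ?thesis by (simp add: norm_mult norm_power)
  qed
  show thesis
  proof (rule that[of "\<lambda>j. sqrt (M j)"])
    show "cmod (f j z) \<le> sqrt (M j)" if "cmod z \<le> R / 2" for j z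
      using bound[OF that] by (rule real_le_rsqrt)
  qed (use summable M0 in simp_all)
qed

text \<open>Cauchy's inequality on the disc of radius \<open>r / 2\<close> around \<open>z\<close>,
  which stays inside \<open>cball 0 r\<close>.\<close>

lemma higher_deriv_bound_half_ball:
  assumes hol: "f holomorphic_on ball 0 e" and r: "0 < r" "r < e"
    and B: "\<And>z. cmod z \<le> r \<Longrightarrow> cmod (f z) \<le> B" and z: "cmod z \<le> r / 2"
  shows "cmod ((deriv ^^ n) f z) \<le> fact n * B / (r / 2) ^ n"
proof (rule Cauchy_inequality)
  have sub: "cball z (r / 2) \<subseteq> cball 0 r"
  proof
    fix w assume "w \<in> cball z (r / 2)"
    then show "w \<in> cball 0 r"
      using z norm_triangle_ineq[of z "w - z"] by (simp add: dist_norm norm_minus_commute)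
  qed
  then have sub': "cball z (r / 2) \<subseteq> ball 0 e" using r by force
  then show "f holomorphic_on ball z (r / 2)"
    using hol holomorphic_on_subset ball_subset_cball by blast
  show "continuous_on (cball z (r / 2)) f"
    using hol sub' holomorphic_on_imp_continuous_on continuous_on_subset by blast
  show "cmod (f w) \<le> B" if "cmod (z - w) = r / 2" for w
    using B sub that by (auto simp: dist_norm)
qed (use r in simp)

lemma sums_tail_bound:
  fixes a :: "nat \<Rightarrow> complex"
  assumes b: "summable b" and le: "\<And>i. cmod (a i) \<le> b i" and a: "a sums s"
  shows "cmod ((\<Sum>i<n. a i) - s) \<le> (\<Sum>i. b (i + n))"
proof -
  have sa: "summable a" using a by (rule sums_summable)
  have sb: "summable (\<lambda>i. b (i + n))" using b by (simp add: summable_iff_shift)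
  have "s = (\<Sum>i. a (i + n)) + (\<Sum>i<n. a i)"
    using suminf_split_initial_segment[OF sa, of n] sums_unique[OF a] by simp
  then have "cmod ((\<Sum>i<n. a i) - s) = cmod (\<Sum>i. a (i + n))"
    by (simp add: norm_minus_commute)
  also have "\<dots> \<le> (\<Sum>i. b (i + n))"
    by (rule norm_suminf_le[OF _ sb]) (rule le)
  finally show ?thesis .
qed

text \<open>Termwise differentiation of a Hermitian product: every series involved is dominated by
  the squares of \<open>\<mu>\<close>, uniformly in the point. The derivative splits into a complex
  linear and a conjugate linear part.\<close>

lemma has_derivative_suminf_mult_cnj:
  fixes f g f' g' :: "nat \<Rightarrow> complex \<Rightarrow> complex"
  assumes f: "\<And>j z. cmod z < r \<Longrightarrow> (f j has_field_derivative f' j z) (at z)"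
    and g: "\<And>j z. cmod z < r \<Longrightarrow> (g j has_field_derivative g' j z) (at z)"
    and \<mu>: "summable (\<lambda>j. (\<mu> j)\<^sup>2)"
    and bounds: "\<And>j z. cmod z < r \<Longrightarrow> cmod (f j z) \<le> \<mu> j" "\<And>j z. cmod z < r \<Longrightarrow> cmod (f' j z) \<le> \<mu> j"
      "\<And>j z. cmod z < r \<Longrightarrow> cmod (g j z) \<le> \<mu> j" "\<And>j z. cmod z < r \<Longrightarrow> cmod (g' j z) \<le> \<mu> j"
    and M: "\<And>z. cmod z < r \<Longrightarrow> (\<lambda>j. f j z * cnj (g j z)) sums M z"
    and z: "cmod z < r"
  shows "(M has_derivative (\<lambda>v. (\<Sum>j. f' j z * cnj (g j z)) * v + (\<Sum>j. f j z * cnj (g' j z)) * cnj v)) (at z)"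
proof -
  have \<mu>0: "0 \<le> \<mu> j" for j
    using bounds(1)[OF z, of j] norm_ge_zero[of "f j z"] by linarith
  define D where "D x v = (\<Sum>j. f' j x * cnj (g j x)) * v + (\<Sum>j. f j x * cnj (g' j x)) * cnj v" for x v
  have prod: "cmod (a * cnj b) \<le> (\<mu> j)\<^sup>2" if "cmod a \<le> \<mu> j" "cmod b \<le> \<mu> j" for a b j
    unfolding norm_mult complex_mod_cnj power2_eq_square using that by (intro mult_mono \<mu>0) auto
  have s: "(\<lambda>j. a j * cnj (b j)) sums (\<Sum>j. a j * cnj (b j))"
    if "\<And>j. cmod (a j) \<le> \<mu> j" "\<And>j. cmod (b j) \<le> \<mu> j" for a b
    by (rule summable_sums, rule summable_comparison_test'[OF \<mu>, of 0]) (simp add: prod that)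
  have "\<exists>G. \<forall>x\<in>ball 0 r. (\<lambda>j. f j x * cnj (g j x)) sums G x \<and> (G has_derivative D x) (at x within ball 0 r)"
  proof (rule has_derivative_series[where f' = "\<lambda>j x v. f j x * cnj (g' j x * v) + f' j x * v * cnj (g j x)"])
    show "((\<lambda>x. f j x * cnj (g j x)) has_derivative
        (\<lambda>v. f j x * cnj (g' j x * v) + f' j x * v * cnj (g j x))) (at x within ball 0 r)"
      if "x \<in> ball 0 r" for j x
    proof -
      have "cmod x < r" using that by simp
      note this[THEN f, of j, unfolded has_field_derivative_def, THEN has_derivative_at_withinI]
        this[THEN g, of j, unfolded has_field_derivative_def, THEN has_derivative_at_withinI]
      from has_derivative_mult[OF this(1) has_derivative_cnj[OF this(2)]] show ?thesis .
    qed
  next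
    fix e :: real assume e: "e > 0"
    have "(\<lambda>n. \<Sum>i. (\<mu> (i + n))\<^sup>2) \<longlonglongrightarrow> 0"
      by (rule suminf_exist_split2[OF \<mu>])
    \<comment> \<open>Half of \<open>e\<close> is spent on each of the two parts, \<open>?a\<close>
      and \<open>?b\<close>.\<close>
    then have "\<forall>\<^sub>F n in sequentially. (\<Sum>i. (\<mu> (i + n))\<^sup>2) < e / 2"
      by (rule order_tendstoD) (use e in simp)
    then show "\<forall>\<^sub>F n in sequentially. \<forall>x\<in>ball 0 r. \<forall>v.
        norm ((\<Sum>i<n. f i x * cnj (g' i x * v) + f' i x * v * cnj (g i x)) - D x v) \<le> e * norm v"
    proof (rule eventually_mono, intro ballI allI)
      fix n x and v :: complex
      assume n: "(\<Sum>i. (\<mu> (i + n))\<^sup>2) < e / 2" and "x \<in> ball (0::complex) r"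
      then have x: "cmod x < r" by simp
      let ?a = "(\<Sum>i<n. f' i x * cnj (g i x)) - (\<Sum>j. f' j x * cnj (g j x))"
      let ?b = "(\<Sum>i<n. f i x * cnj (g' i x)) - (\<Sum>j. f j x * cnj (g' j x))"
      have "cmod ?a \<le> (\<Sum>i. (\<mu> (i + n))\<^sup>2)" "cmod ?b \<le> (\<Sum>i. (\<mu> (i + n))\<^sup>2)"
        by (intro sums_tail_bound[OF \<mu>] s prod bounds x)+
      then have ab: "cmod ?a + cmod ?b \<le> e" using n by linarith
      have eq: "(\<Sum>i<n. f i x * cnj (g' i x * v) + f' i x * v * cnj (g i x)) - D x v = ?a * v + ?b * cnj v"
        unfolding D_def sum.distrib left_diff_distrib sum_distrib_right by (simp add: mult_ac)
      have "cmod (?a * v + ?b * cnj v) \<le> cmod ?a * cmod v + cmod ?b * cmod v"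
        using norm_triangle_ineq[of "?a * v" "?b * cnj v"] by (simp only: norm_mult complex_mod_cnj)
      also have "\<dots> \<le> e * cmod v"
        using mult_right_mono[OF ab norm_ge_zero[of v]] by (simp only: distrib_right)
      finally show "norm ((\<Sum>i<n. f i x * cnj (g' i x * v) + f' i x * v * cnj (g i x)) - D x v) \<le> e * norm v"
        unfolding eq .
    qed
  next
    show "z \<in> ball 0 r" using z by simp
    show "(\<lambda>j. f j z * cnj (g j z)) sums M z" by (rule M[OF z])
  qed (rule convex_ball)
  then obtain G where "\<forall>x\<in>ball 0 r. (\<lambda>j. f j x * cnj (g j x)) sums G x \<and> (G has_derivative D x) (at x within ball 0 r)"
    by blast
  then have G: "\<And>x. cmod x < r \<Longrightarrow> (\<lambda>j. f j x * cnj (g j x)) sums G x"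
    "\<And>x. cmod x < r \<Longrightarrow> (G has_derivative D x) (at x within ball 0 r)"
    by simp_all
  have "(G has_derivative D z) (at z)"
    using G(2)[OF z] z by (simp add: at_within_open[of z "ball 0 r"])
  then have "(M has_derivative D z) (at z)"
  proof (rule has_derivative_transform_within_open)
    show "G x = M x" if "x \<in> ball 0 r" for x
      using sums_unique2[OF G(1)[of x] M[of x]] that by simp
  qed (use z in auto)
  then show ?thesis unfolding D_def .
qed

text \<open>One square summable sequence dominates the coordinates and their first two derivatives,
  so the series for \<open>cinner (H z) (h z)\<close> can be differentiated termwise. Its conjugate
  linear part is the squared norm of \<open>H z\<close>; \<open>a\<close> is the product of the
  second derivative with \<open>h\<close>.\<close>

lemma ell2_curve_derivatives:
  fixes h H :: "complex \<Rightarrow> ell2"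
  assumes e: "e > 0" and h: "\<And>z. cmod z < e \<Longrightarrow> (h has_derivative (\<lambda>v. v *\<^sub>C H z)) (at z)"
  obtains r \<mu> a where "0 < r" "r < e" "summable (\<lambda>j. (\<mu> j)\<^sup>2)"
    "\<And>j z. cmod z < r \<Longrightarrow> cmod (coord (h z) j) \<le> \<mu> j"
    "\<And>j. (\<lambda>z. coord (h z) j) holomorphic_on ball 0 r"
    "\<And>z. cmod z < r \<Longrightarrow> ((\<lambda>z. cinner (H z) (h z)) has_derivative
       (\<lambda>v. a z * v + of_real ((norm (H z))\<^sup>2) * cnj v)) (at z)"
proof -
  define f where "f j z = coord (h z) j" for j z
  have df: "(f j has_field_derivative coord (H z) j) (at z)" if "cmod z < e" for j z
  proof -
    have "((\<lambda>z. coord (h z) j) has_derivative (\<lambda>v. coord (v *\<^sub>C H z) j)) (at z)"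
      by (rule bounded_linear.has_derivative[OF bounded_linear_coord h[OF that]])
    moreover have "(\<lambda>v. coord (v *\<^sub>C H z) j) = (*) (coord (H z) j)"
      by (auto simp: scaleC_ell2.rep_eq)
    ultimately show ?thesis by (simp add: has_field_derivative_def f_def[abs_def])
  qed
  have hol: "f j holomorphic_on ball 0 e" for j
    using df unfolding holomorphic_on_open[OF open_ball] by (meson mem_ball_0)
  have "continuous_on (cball 0 (e / 2)) h"
    using e by (intro continuous_at_imp_continuous_on ballI has_derivative_continuous[OF h]) auto
  then have "continuous_on (cball 0 (e / 2)) (\<lambda>z. (norm (h z))\<^sup>2)"
    by (intro continuous_intros)
  then have "bounded ((\<lambda>z. (norm (h z))\<^sup>2) ` cball 0 (e / 2))"
    by (intro compact_imp_bounded compact_continuous_image) auto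
  then obtain K where K: "\<And>z. cmod z \<le> e / 2 \<Longrightarrow> (norm (h z))\<^sup>2 \<le> K"
    unfolding bounded_iff by fastforce
  have partial: "(\<Sum>j<n. (cmod (f j z))\<^sup>2) \<le> K" if "cmod z = e / 2" for z n
  proof -
    have "(\<Sum>j<n. (cmod (f j z))\<^sup>2) \<le> (norm (h z))\<^sup>2"
      unfolding norm_ell2_sq f_def by (rule sum_le_suminf[OF summable_coord]) auto
    also have "\<dots> \<le> K" using K that by simp
    finally show ?thesis .
  qed
  obtain \<mu>0 where \<mu>0: "summable (\<lambda>j. (\<mu>0 j)\<^sup>2)" "\<And>j. 0 \<le> \<mu>0 j"
    "\<And>j z. cmod z \<le> e / 2 / 2 \<Longrightarrow> cmod (f j z) \<le> \<mu>0 j"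
    using square_summable_uniform_bound[of "e / 2" e f K] hol partial e by (metis half_gt_zero field_sum_of_halves less_add_same_cancel1)
  \<comment> \<open>The halvings lead from \<open>e\<close> to the circle of radius
    \<open>e / 2\<close>, then to the disc with uniform bounds, then to the disc with Cauchy
    estimates.\<close>
  define r where "r = e / 2 / 2 / 2"
  have r: "0 < r" "r < e" using e by (simp_all add: r_def)
  \<comment> \<open>The summands are the factors \<open>fact n / r ^ n\<close> of the Cauchy
    estimates for \<open>n = 0, 1, 2\<close>.\<close>
  define c where "c = 1 + 1 / r + 2 / r\<^sup>2"
  have c: "1 \<le> c" "1 / r \<le> c" "2 / r\<^sup>2 \<le> c" using r by (simp_all add: c_def)
  define \<mu> where "\<mu> j = c * \<mu>0 j" for j
  have \<mu>: "summable (\<lambda>j. (\<mu> j)\<^sup>2)"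
    unfolding \<mu>_def power_mult_distrib by (intro summable_mult \<mu>0)
  have hb: "cmod ((deriv ^^ n) (f j) z) \<le> fact n * \<mu>0 j / r ^ n" if "cmod z < r" for n j z
    unfolding r_def
    by (rule higher_deriv_bound_half_ball[OF hol]) (use e that in \<open>auto simp: r_def intro!: \<mu>0\<close>)
  have b0: "cmod (f j z) \<le> \<mu> j" if "cmod z < r" for j z
    using hb[OF that, of 0 j] mult_right_mono[OF c(1) \<mu>0(2), of j] by (simp add: \<mu>_def)
  have b1: "cmod (coord (H z) j) \<le> \<mu> j" if "cmod z < r" for j z
    using hb[OF that, of 1 j] mult_right_mono[OF c(2) \<mu>0(2), of j] DERIV_imp_deriv[OF df, of z j] that r
    by (simp add: \<mu>_def)
  have b2: "cmod (deriv (deriv (f j)) z) \<le> \<mu> j" if "cmod z < r" for j z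
    using hb[OF that, of 2 j] mult_right_mono[OF c(3) \<mu>0(2), of j]
    by (simp add: \<mu>_def eval_nat_numeral)
  have dH: "((\<lambda>z. coord (H z) j) has_field_derivative deriv (deriv (f j)) z) (at z)" if z: "cmod z < r" for j z
  proof -
    have "deriv (f j) holomorphic_on ball 0 e" by (rule holomorphic_deriv[OF hol open_ball])
    then have "(deriv (f j) has_field_derivative deriv (deriv (f j)) z) (at z)"
      by (rule holomorphic_derivI[OF _ open_ball]) (use z r in simp)
    then show ?thesis
      by (rule has_field_derivative_transform_within_open[of _ _ _ "ball 0 e"])
         (use z r in \<open>auto intro!: DERIV_imp_deriv df\<close>)
  qed
  show thesis
  proof (rule that[OF r \<mu>, of "\<lambda>z. \<Sum>j. deriv (deriv (f j)) z * cnj (coord (h z) j)"])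
    show "cmod (coord (h z) j) \<le> \<mu> j" if "cmod z < r" for j z
      using b0[OF that] by (simp add: f_def)
    show "(\<lambda>z. coord (h z) j) holomorphic_on ball 0 r" for j
      using hol[of j] r unfolding f_def[abs_def] by (rule_tac holomorphic_on_subset) auto
    fix z assume z: "cmod z < r"
    have "(\<Sum>j. coord (H z) j * cnj (coord (H z) j)) = of_real ((norm (H z))\<^sup>2)"
    proof -
      have "cinner (H z) (H z) = of_real ((norm (H z))\<^sup>2)"
        by (metis Re_cinner cinner_commute complex_cnj_cancel_iff Reals_cnj_iff complex_is_Real_iff of_real_Re power2_norm_eq_inner)
      then show ?thesis using sums_unique[OF cinner_sums, of "H z" "H z"] by simp
    qed
    moreover have cs: "(\<lambda>j. coord (H z) j * cnj (f j z)) sums cinner (H z) (h z)" for z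
      unfolding f_def by (rule cinner_sums)
    have "((\<lambda>z. cinner (H z) (h z)) has_derivative
       (\<lambda>v. (\<Sum>j. deriv (deriv (f j)) z * cnj (f j z)) * v
          + (\<Sum>j. coord (H z) j * cnj (coord (H z) j)) * cnj v)) (at z)"
      by (rule has_derivative_suminf_mult_cnj[where r = r and \<mu> = \<mu> and f = "\<lambda>j z. coord (H z) j" and g = f])
         (use dH df b0 b1 b2 \<mu> z r in \<open>auto simp: cs\<close>)
    ultimately show "((\<lambda>z. cinner (H z) (h z)) has_derivative
       (\<lambda>v. (\<Sum>j. deriv (deriv (f j)) z * cnj (coord (h z) j)) * v
          + of_real ((norm (H z))\<^sup>2) * cnj v)) (at z)"
      by (simp add: f_def)
  qed
qed

section \<open>Non-existence of Kaehler immersions\<close>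

text \<open>
  The metric equation says that the \<open>(1, 0)\<close>-part \<open>V\<close> of the differential of
  \<open>ln (1 + |h|\<^sup>2) - \<psi> (|z|\<^sup>2)\<close> is holomorphic; a primitive of \<open>V\<close> yields the factor \<open>G\<close>.
\<close>
lemma exp_potential_factor:
  fixes h H :: "complex \<Rightarrow> ell2" and \<psi> \<psi>1 \<psi>2 :: "real \<Rightarrow> real"
  assumes r: "r > 0"
    and h: "\<And>z. cmod z < r \<Longrightarrow> (h has_derivative (\<lambda>v. v *\<^sub>C H z)) (at z)"
    and M: "\<And>z. cmod z < r \<Longrightarrow> ((\<lambda>z. cinner (H z) (h z)) has_derivative
       (\<lambda>v. a z * v + of_real ((norm (H z))\<^sup>2) * cnj v)) (at z)"
    and \<psi>1: "\<And>x. 0 \<le> x \<Longrightarrow> x < r\<^sup>2 \<Longrightarrow> (\<psi> has_real_derivative \<psi>1 x) (at x)"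
    and \<psi>2: "\<And>x. 0 \<le> x \<Longrightarrow> x < r\<^sup>2 \<Longrightarrow> (\<psi>1 has_real_derivative \<psi>2 x) (at x)"
    and metric: "\<And>z. cmod z < r \<Longrightarrow> (norm (H z))\<^sup>2 / (1 + (norm (h z))\<^sup>2)
        - (cmod (cinner (H z) (h z)))\<^sup>2 / (1 + (norm (h z))\<^sup>2)\<^sup>2
        = \<psi>1 ((cmod z)\<^sup>2) + (cmod z)\<^sup>2 * \<psi>2 ((cmod z)\<^sup>2)"
  obtains G where "G holomorphic_on ball 0 r"
    "\<And>z. cmod z < r \<Longrightarrow> exp (\<psi> ((cmod z)\<^sup>2)) = (cmod (G z))\<^sup>2 * (1 + (norm (h z))\<^sup>2)"
proof -
  define D where "D z = 1 + (norm (h z))\<^sup>2" for z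
  define P where "P z = cinner (H z) (h z)" for z
  \<comment> \<open>The first term is the z-derivative of \<open>ln (D z)\<close>, the second that
    of \<open>\<psi> ((cmod z)\<^sup>2)\<close>.\<close>
  define V where "V z = P z / of_real (D z) - cnj z * of_real (\<psi>1 ((cmod z)\<^sup>2))" for z
  have D0: "D z > 0" for z
    unfolding D_def using zero_le_power2[of "norm (h z)"] by linarith
  have small: "(cmod z)\<^sup>2 < r\<^sup>2" if "cmod z < r" for z
    using that by (intro power_strict_mono) auto
  have dD: "(D has_derivative (\<lambda>v. 2 * Re (v * P z))) (at z)" if z: "cmod z < r" for z
  proof -
    have "((\<lambda>z. 1 + h z \<bullet> h z) has_derivative (\<lambda>v. 0 + (h z \<bullet> (v *\<^sub>C H z) + (v *\<^sub>C H z) \<bullet> h z))) (at z)"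
      by (intro has_derivative_add has_derivative_const has_derivative_inner h z)
    moreover have "h z \<bullet> (v *\<^sub>C H z) + (v *\<^sub>C H z) \<bullet> h z = 2 * Re (v * P z)" for v
      unfolding P_def cinner_scaleC_left[symmetric] Re_cinner by (simp add: inner_commute)
    ultimately show ?thesis
      by (simp add: D_def[abs_def] power2_norm_eq_inner)
  qed
  have drad: "((\<lambda>z. (cmod z)\<^sup>2) has_derivative (\<lambda>v. 2 * Re (cnj z * v))) (at z)" for z
  proof -
    have "((\<lambda>z. z \<bullet> z) has_derivative (\<lambda>v. z \<bullet> v + v \<bullet> z)) (at z)"
      by (intro has_derivative_inner has_derivative_ident)
    moreover have "z \<bullet> v + v \<bullet> z = 2 * Re (cnj z * v)" for v
      by (simp add: inner_complex_def)
    ultimately show ?thesis by (simp add: power2_norm_eq_inner)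
  qed
  have d\<psi>: "((\<lambda>z. \<psi> ((cmod z)\<^sup>2)) has_derivative (\<lambda>v. 2 * Re (cnj z * v) * \<psi>1 ((cmod z)\<^sup>2))) (at z)"
    "((\<lambda>z. \<psi>1 ((cmod z)\<^sup>2)) has_derivative (\<lambda>v. 2 * Re (cnj z * v) * \<psi>2 ((cmod z)\<^sup>2))) (at z)"
    if z: "cmod z < r" for z
    using DERIV_compose_FDERIV[OF \<psi>1[OF zero_le_power2 small[OF z]] drad]
      DERIV_compose_FDERIV[OF \<psi>2[OF zero_le_power2 small[OF z]] drad] by simp_all
  have twoRe: "complex_of_real (2 * Re w) = w + cnj w" for w
    by (simp add: complex_eq_iff)
  \<comment> \<open>The coefficient of \<open>cnj v\<close> in the differential of \<open>V\<close>
    is the difference of the two sides of the metric equation; its vanishing leaves a complex linear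
    map.\<close>
  have alg: "- p * (inverse d * (v * p + cnj (v * p)) * inverse d) + (a' * v + b * cnj v) / d
      - (cnj z * ((cnj z * v + cnj (cnj z * v)) * s) + cnj v * q)
      = (a' / d - p\<^sup>2 / d\<^sup>2 - (cnj z)\<^sup>2 * s) * v"
    if "b / d - p * cnj p / d\<^sup>2 = q + z * cnj z * s" for p d v a' b z s q :: complex
  proof -
    have "- p * (inverse d * (v * p + cnj (v * p)) * inverse d) + (a' * v + b * cnj v) / d
        - (cnj z * ((cnj z * v + cnj (cnj z * v)) * s) + cnj v * q)
        - (a' / d - p\<^sup>2 / d\<^sup>2 - (cnj z)\<^sup>2 * s) * v
        = cnj v * ((b / d - p * cnj p / d\<^sup>2) - (q + z * cnj z * s))"
      by (simp add: divide_inverse power2_eq_square algebra_simps)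
    then show ?thesis using that by simp
  qed
  have dV: "V field_differentiable (at z)" if z: "cmod z < r" for z
  proof -
    let ?R = "(cmod z)\<^sup>2"
    have eq: "complex_of_real ((norm (H z))\<^sup>2) / of_real (D z) - P z * cnj (P z) / (of_real (D z))\<^sup>2
        = of_real (\<psi>1 ?R) + z * cnj z * of_real (\<psi>2 ?R)"
      using arg_cong[OF metric[OF z], of complex_of_real]
      by (simp add: D_def P_def flip: complex_norm_square)
    have "((\<lambda>z. complex_of_real (D z)) has_derivative (\<lambda>v. complex_of_real (2 * Re (v * P z)))) (at z)"
      by (rule has_derivative_of_real[OF dD[OF z]])
    moreover have "((\<lambda>z. complex_of_real (\<psi>1 ((cmod z)\<^sup>2))) has_derivative
        (\<lambda>v. complex_of_real (2 * Re (cnj z * v) * \<psi>2 ?R))) (at z)"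
      by (rule has_derivative_of_real[OF d\<psi>(2)[OF z]])
    ultimately have "(V has_derivative (\<lambda>v.
        - P z * (inverse (of_real (D z)) * of_real (2 * Re (v * P z)) * inverse (of_real (D z)))
        + (a z * v + of_real ((norm (H z))\<^sup>2) * cnj v) / of_real (D z)
        - (cnj z * of_real (2 * Re (cnj z * v) * \<psi>2 ?R) + cnj v * of_real (\<psi>1 ?R)))) (at z)"
      unfolding V_def[abs_def] P_def[abs_def] using D0[of z]
      by (intro has_derivative_diff has_derivative_divide has_derivative_mult M z
          has_derivative_cnj has_derivative_ident) auto
    then have "(V has_derivative (\<lambda>v. (a z / of_real (D z) - (P z)\<^sup>2 / (of_real (D z))\<^sup>2
        - (cnj z)\<^sup>2 * of_real (\<psi>2 ?R)) * v)) (at z)"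
      by (simp only: of_real_mult[of "2 * _"] twoRe alg[OF eq])
    then show ?thesis
      unfolding field_differentiable_def has_field_derivative_def by blast
  qed
  then have "V holomorphic_on ball 0 r"
    by (auto simp: holomorphic_on_def intro: field_differentiable_at_within)
  then obtain f where f: "\<And>z. z \<in> ball 0 r \<Longrightarrow> (f has_field_derivative V z) (at z within ball 0 r)"
    using holomorphic_convex_primitive'[OF convex_ball open_ball] by blast
  have f': "(f has_field_derivative V z) (at z)" if "cmod z < r" for z
    using f[of z] that by (simp add: at_within_open[of z "ball 0 r"])
  \<comment> \<open>The differential of \<open>ln D - \<psi>\<close> is
    \<open>2 * Re (V z * v)\<close>, which is also that of \<open>2 * Re f\<close>.\<close>
  have "((\<lambda>z. ln (D z) - \<psi> ((cmod z)\<^sup>2) - 2 * Re (f z)) has_derivative (\<lambda>v. 0)) (at z within ball 0 r)"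
    if "z \<in> ball 0 r" for z
  proof -
    have z: "cmod z < r" using that by simp
    have "((\<lambda>z. Re (f z)) has_derivative (\<lambda>v. Re (V z * v))) (at z)"
      using f'[OF z] unfolding has_field_derivative_def by (rule has_derivative_Re)
    then have "((\<lambda>z. ln (D z) - \<psi> ((cmod z)\<^sup>2) - 2 * Re (f z)) has_derivative
        (\<lambda>v. 2 * Re (v * P z) * inverse (D z) - 2 * Re (cnj z * v) * \<psi>1 ((cmod z)\<^sup>2) - 2 * Re (V z * v))) (at z)"
      by (intro has_derivative_diff has_derivative_ln d\<psi> dD z D0 has_derivative_mult_right)
    moreover have "2 * Re (v * P z) * inverse (D z) - 2 * Re (cnj z * v) * \<psi>1 ((cmod z)\<^sup>2) - 2 * Re (V z * v) = 0" for v
    proof -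
      have "V z * v = of_real (inverse (D z)) * (v * P z) - of_real (\<psi>1 ((cmod z)\<^sup>2)) * (cnj z * v)"
        by (simp add: V_def divide_inverse algebra_simps)
      moreover have "Re (of_real s * w - of_real t * u) = s * Re w - t * Re u" for s t w u
        by simp
      ultimately have "Re (V z * v) = inverse (D z) * Re (v * P z) - \<psi>1 ((cmod z)\<^sup>2) * Re (cnj z * v)"
        by (simp only:)
      then show ?thesis by (simp only:) (simp add: algebra_simps)
    qed
    ultimately show ?thesis by (simp only:) (rule has_derivative_at_withinI)
  qed
  then have "\<exists>c. \<forall>z\<in>ball 0 r. ln (D z) - \<psi> ((cmod z)\<^sup>2) - 2 * Re (f z) = c"
    by (rule has_derivative_zero_constant[OF convex_ball])
  then obtain c where c: "\<And>z. z \<in> ball 0 r \<Longrightarrow> ln (D z) - \<psi> ((cmod z)\<^sup>2) - 2 * Re (f z) = c"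
    by blast
  show thesis
  \<comment> \<open>The squared modulus of this exponential is
    \<open>exp (- 2 * Re (f z) - c)\<close>, the quotient of
    \<open>exp (\<psi> ((cmod z)\<^sup>2))\<close> by \<open>D z\<close>.\<close>
  proof (rule that[of "\<lambda>z. exp (- (f z + of_real (c / 2)))"])
    have "f holomorphic_on ball 0 r" unfolding holomorphic_on_open[OF open_ball] using f' by fastforce
    then show "(\<lambda>z. exp (- (f z + of_real (c / 2)))) holomorphic_on ball 0 r"
      by (intro holomorphic_intros)
    fix z assume "cmod z < r"
    then have "\<psi> ((cmod z)\<^sup>2) = 2 * (- (Re (f z) + c / 2)) + ln (D z)"
      using c[of z] by simp
    then have "exp (\<psi> ((cmod z)\<^sup>2)) = (exp (- (Re (f z) + c / 2)))\<^sup>2 * D z"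
      using D0[of z] by (simp only: exp_add exp_double exp_ln)
    then show "exp (\<psi> ((cmod z)\<^sup>2)) = (cmod (exp (- (f z + of_real (c / 2)))))\<^sup>2 * (1 + (norm (h z))\<^sup>2)"
      by (simp add: D_def norm_exp_eq_Re)
  qed
qed

text \<open>The coefficient of \<open>z ^ n * cnj z ^ n\<close> in the sum of the squared moduli is
  the sum over \<open>j\<close> of the squared moduli of the Taylor coefficients
  \<open>c j n\<close>. By uniqueness of double series it equals the Taylor coefficient of
  \<open>f\<close>.\<close>

lemma sum_norm_squares_coeff_nonneg:
  fixes g :: "nat \<Rightarrow> complex \<Rightarrow> complex"
  assumes r: "r > 0" "r\<^sup>2 \<le> \<rho>"
    and g: "\<And>j. g j holomorphic_on ball 0 r" "\<And>j z. cmod z < r \<Longrightarrow> cmod (g j z) \<le> \<mu> j"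
    and \<mu>: "summable (\<lambda>j. (\<mu> j)\<^sup>2)"
    and f: "f holomorphic_on ball 0 \<rho>"
    and sums: "\<And>z. cmod z < r \<Longrightarrow> (\<lambda>j. complex_of_real ((cmod (g j z))\<^sup>2)) sums f (of_real ((cmod z)\<^sup>2))"
  shows "0 \<le> Re (fps_nth (fps_expansion f 0) n)"
proof -
  define c where "c j n = fps_nth (fps_expansion (g j) 0) n" for j n
  define q where "q = r / 2 / 2"
  have q: "q > 0" using r by (simp add: q_def)
  have c_bound: "cmod (c j n) \<le> \<mu> j / q ^ n" for j n
  proof -
    have "cmod ((deriv ^^ n) (g j) 0) \<le> fact n * \<mu> j / (r / 2 / 2) ^ n"
      by (rule higher_deriv_bound_half_ball[OF g(1)]) (use r in \<open>auto intro!: g(2)\<close>)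
    then show ?thesis by (simp add: c_def fps_expansion_def q_def norm_divide field_simps)
  qed
  have \<mu>0: "0 \<le> \<mu> j" for j
    using g(2)[of 0 j] r norm_ge_zero[of "g j 0"] by (simp del: norm_ge_zero)
  have \<mu>_on: "(\<lambda>j. (\<mu> j)\<^sup>2) summable_on UNIV"
    using \<mu> by (simp add: summable_on_UNIV_nonneg_real_iff)
  define C where "C n k = (\<Sum>\<^sub>\<infinity>j. c j n * cnj (c j k))" for n k
  have C: "((\<lambda>j. c j n * cnj (c j k)) has_sum C n k) UNIV" for n k
  proof -
    have "(\<lambda>j. norm (c j n * cnj (c j k))) summable_on UNIV"
    proof (rule Infinite_Sum.abs_summable_on_comparison_test')
      show "(\<lambda>j. (\<mu> j)\<^sup>2 * (1 / q ^ n * (1 / q ^ k))) summable_on UNIV"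
        by (intro summable_on_cmult_left \<mu>_on)
      show "norm (c j n * cnj (c j k)) \<le> (\<mu> j)\<^sup>2 * (1 / q ^ n * (1 / q ^ k))" for j
        using mult_mono[OF c_bound[of j n] c_bound[of j k]] \<mu>0[of j] q
        by (simp add: norm_mult power2_eq_square)
    qed
    then show ?thesis
      unfolding C_def by (rule has_sum_infsum[OF abs_summable_summable])
  qed
  have expansion: "((\<lambda>(n, k). C n k * z ^ n * cnj z ^ k) has_sum f (of_real ((cmod z)\<^sup>2))) UNIV"
    if z: "cmod z < q / 2" for z
  proof -
    define t where "t j n k = c j n * cnj (c j k) * z ^ n * cnj z ^ k" for j n k
    have zr: "cmod z < r" using z r by (simp add: q_def)
    \<comment> \<open>Each Taylor coefficient is at most \<open>\<mu> j / q ^ n\<close>; the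
      restriction to \<open>q / 2\<close> leaves a geometric factor.\<close>
    have le: "cmod (c j n * z ^ n) \<le> \<mu> j * (1 / 2) ^ n" for j n
    proof -
      have "cmod (c j n * z ^ n) \<le> \<mu> j / q ^ n * (q / 2) ^ n"
        unfolding norm_mult norm_power using z q \<mu>0[of j]
        by (intro mult_mono c_bound power_mono) auto
      then show ?thesis using q by (simp add: power_divide)
    qed
    have t_eq: "t j n k = (c j n * z ^ n) * cnj (c j k * z ^ k)" for j n k
      by (simp add: t_def)
    have t_bound: "cmod (t j n k) \<le> (\<mu> j)\<^sup>2 * ((1 / 2) ^ n * (1 / 2) ^ k)" for j n k
    proof -
      have "cmod (t j n k) = cmod (c j n * z ^ n) * cmod (c j k * z ^ k)"
        unfolding t_eq norm_mult[of "c j n * z ^ n"] complex_mod_cnj ..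
      also have "\<dots> \<le> (\<mu> j * (1 / 2) ^ n) * (\<mu> j * (1 / 2) ^ k)"
        by (intro mult_mono le) (use \<mu>0 in auto)
      finally show ?thesis by (simp add: power2_eq_square mult_ac)
    qed
    have geo: "((\<lambda>k. (1 / 2 :: real) ^ k) has_sum 2) UNIV"
      using geometric_sums[of "1 / 2 :: real"] by (intro sums_nonneg_imp_has_sum) auto
    have geo2: "(\<lambda>(n, k). (1 / 2 :: real) ^ n * (1 / 2) ^ k) summable_on (UNIV \<times> UNIV)"
    proof (rule summable_on_SigmaI)
      show "((\<lambda>k. case (n, k) of (n, k) \<Rightarrow> (1 / 2 :: real) ^ n * (1 / 2) ^ k) has_sum (1 / 2) ^ n * 2) UNIV" for n :: nat
        using has_sum_cmult_right[OF geo] by simp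
      show "(\<lambda>n. (1 / 2 :: real) ^ n * 2) summable_on UNIV"
        by (intro summable_on_cmult_left has_sum_imp_summable[OF geo])
    qed auto
    \<comment> \<open>Absolute summability of the triple family allows it to be summed in two
      orders: over \<open>(n, k)\<close> first, giving the squared moduli, or over \<open>j\<close>
      first, giving \<open>C n k\<close>.\<close>
    have "(\<lambda>(j, n, k). (\<mu> j)\<^sup>2 * ((1 / 2) ^ n * (1 / 2) ^ k)) summable_on (UNIV \<times> (UNIV \<times> UNIV))"
    proof (rule summable_on_SigmaI)
      show "((\<lambda>p. case (j, p) of (j, n, k) \<Rightarrow> (\<mu> j)\<^sup>2 * ((1 / 2) ^ n * (1 / 2) ^ k))
          has_sum (\<mu> j)\<^sup>2 * (\<Sum>\<^sub>\<infinity>(n, k)\<in>UNIV \<times> UNIV. (1 / 2) ^ n * (1 / 2) ^ k)) (UNIV \<times> UNIV)" for j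
        using has_sum_cmult_right[OF has_sum_infsum[OF geo2], of "(\<mu> j)\<^sup>2"] by (simp add: case_prod_unfold)
      show "(\<lambda>j. (\<mu> j)\<^sup>2 * (\<Sum>\<^sub>\<infinity>(n, k)\<in>UNIV \<times> UNIV. (1 / 2) ^ n * (1 / 2) ^ k)) summable_on UNIV"
        by (intro summable_on_cmult_left \<mu>_on)
    qed auto
    then have "(\<lambda>x. norm (case x of (j, n, k) \<Rightarrow> t j n k)) summable_on (UNIV \<times> (UNIV \<times> UNIV))"
      by (rule Infinite_Sum.abs_summable_on_comparison_test') (auto simp: t_bound)
    then have t_summable: "(\<lambda>(j, n, k). t j n k) summable_on (UNIV \<times> (UNIV \<times> UNIV))"
      by (rule abs_summable_summable)
    then obtain S where S: "((\<lambda>(j, n, k). t j n k) has_sum S) (UNIV \<times> (UNIV \<times> UNIV))"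
      unfolding summable_on_def by blast
    have row: "((\<lambda>(n, k). t j n k) has_sum of_real ((cmod (g j z))\<^sup>2)) (UNIV \<times> UNIV)" for j
    proof -
      have "(\<lambda>p. (\<lambda>j (n, k). t j n k) j p) summable_on (UNIV \<times> UNIV)"
        by (rule summable_on_SigmaD1[of "\<lambda>j (n, k). t j n k" UNIV "\<lambda>_. UNIV \<times> UNIV"])
           (use t_summable in \<open>simp_all add: case_prod_unfold\<close>)
      then obtain s where s: "((\<lambda>(n, k). t j n k) has_sum s) (UNIV \<times> UNIV)"
        unfolding summable_on_def by auto
      have "summable (\<lambda>n. norm (c j n * z ^ n))"
      proof (rule summable_comparison_test'[of "\<lambda>n. \<mu> j * (1 / 2) ^ n" 0])
        show "summable (\<lambda>n. \<mu> j * (1 / 2) ^ n)" by (intro summable_mult summable_geometric) simp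
      qed (use le in auto)
      moreover have "(\<lambda>n. c j n * z ^ n) sums g j z"
        unfolding c_def
        by (rule has_fps_expansion_imp_sums_complex[of _ _ "ereal r"])
           (use g(1) zr r in \<open>auto intro!: has_fps_expansion_fps_expansion[of "ball 0 r"]\<close>)
      ultimately have gs: "((\<lambda>n. c j n * z ^ n) has_sum g j z) UNIV"
        by (rule norm_summable_imp_has_sum)
      have "((\<lambda>n. (c j n * z ^ n) * cnj (g j z)) has_sum s) UNIV"
        by (rule has_sum_SigmaD[OF s])
           (use has_sum_cmult_right[OF gs[THEN has_sum_cnj_iff[THEN iffD2]]] in \<open>simp add: t_eq\<close>)
      moreover have "((\<lambda>n. (c j n * z ^ n) * cnj (g j z)) has_sum g j z * cnj (g j z)) UNIV"
        by (rule has_sum_cmult_left[OF gs])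
      ultimately have "s = g j z * cnj (g j z)" by (rule has_sum_unique)
      then show ?thesis using s by (simp only: complex_norm_square)
    qed
    have "((\<lambda>j. complex_of_real ((cmod (g j z))\<^sup>2)) has_sum S) UNIV"
      by (rule has_sum_SigmaD[OF S]) (use row in \<open>simp add: case_prod_unfold\<close>)
    then have "S = f (of_real ((cmod z)\<^sup>2))"
      using has_sum_imp_sums sums[OF zr] sums_unique2 by blast
    moreover have "((\<lambda>(n, k). C n k * z ^ n * cnj z ^ k) has_sum S) (UNIV \<times> UNIV)"
    proof (rule has_sum_SigmaD)
      show "((\<lambda>(p, j). case p of (n, k) \<Rightarrow> t j n k) has_sum S) ((UNIV \<times> UNIV) \<times> UNIV)"
        using S by (subst (asm) has_sum_swap) (simp add: case_prod_unfold)
      show "((\<lambda>j. case (p, j) of (p, j) \<Rightarrow> (case p of (n, k) \<Rightarrow> t j n k)) has_sum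
          (case p of (n, k) \<Rightarrow> C n k * z ^ n * cnj z ^ k)) UNIV" for p :: "nat \<times> nat"
        using has_sum_cmult_left[OF C[of "fst p" "snd p"], of "z ^ fst p * cnj z ^ snd p"]
        by (simp add: case_prod_unfold t_def mult.assoc)
    qed
    ultimately show ?thesis by simp
  qed
  have "C n k - (if n = k then fps_nth (fps_expansion f 0) n else 0) = 0" for n k
  proof (rule double_series_zero_coeff[where C = "\<lambda>n k. C n k - (if n = k then fps_nth (fps_expansion f 0) n else 0)"])
    show "q / 2 > 0" using q by simp
    fix z assume z: "cmod z < q / 2"
    then have "cmod z < r" using r by (simp add: q_def)
    then have "(cmod z)\<^sup>2 < r\<^sup>2" by (intro power_strict_mono) auto
    then have "(cmod z)\<^sup>2 < \<rho>" using r by simp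
    from has_sum_minus[OF expansion[OF z] radial_has_sum_diagonal[OF f this]]
    show "((\<lambda>(n, k). (C n k - (if n = k then fps_nth (fps_expansion f 0) n else 0)) * z ^ n * cnj z ^ k)
        has_sum 0) UNIV"
      by (simp only: case_prod_unfold left_diff_distrib diff_self)
  qed
  from this[of n n] have "fps_nth (fps_expansion f 0) n = C n n" by simp
  moreover have "0 \<le> Re (C n n)"
    by (rule has_sum_nonneg[OF has_sum_Re[OF C]]) (simp flip: complex_norm_square)
  ultimately show ?thesis by simp
qed

lemma has_real_derivative_Re_of_real:
  assumes "(f has_field_derivative D) (at (of_real x))"
  shows "((\<lambda>x. Re (f (of_real x))) has_real_derivative Re D) (at x)"
proof -
  have "((\<lambda>x. complex_of_real x) has_derivative of_real) (at x)"
    by (intro has_derivative_of_real has_derivative_ident)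
  from has_derivative_compose[OF this assms[unfolded has_field_derivative_def]]
  have "((\<lambda>x. Re (f (of_real x))) has_derivative (\<lambda>v. Re (D * of_real v))) (at x)"
    by (rule has_derivative_Re)
  moreover have "(\<lambda>v. Re (D * of_real v)) = (*) (Re D)"
    by auto
  ultimately show ?thesis
    unfolding has_field_derivative_def by simp
qed

lemma taub_nut_no_kahler_immersion:
  fixes m \<alpha> :: real
  assumes m: "m > 0" and \<alpha>: "\<alpha> > 0"
  shows "\<not> kahler_immersion (\<lambda>p X Y. \<alpha> * taub_nut_metric m p X Y) N F"
proof
  assume F: "kahler_immersion (\<lambda>p X Y. \<alpha> * taub_nut_metric m p X Y) N F"
  obtain T \<rho> n where \<rho>: "\<rho> > 0" and holT: "T holomorphic_on ball 0 \<rho>"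
    and T: "\<And>z. (cmod (z $ 1))\<^sup>2 < \<rho> \<Longrightarrow>
       T (of_real ((cmod (z $ 1))\<^sup>2)) = of_real (\<alpha> * taub_nut_potential m (axis_incl z))"
    and n: "Re (fps_nth (fps_expansion (\<lambda>x. exp (T x)) 0) n) < 0"
    using taub_nut_axis_holomorphic[OF m \<alpha>] by metis
  \<comment> \<open>\<open>T\<close> is real at the values |z|^2 in its disc, so there the real part
    is \<open>T\<close> itself.\<close>
  define \<psi> where "\<psi> x = Re (T (of_real x))" for x
  define \<psi>1 where "\<psi>1 x = Re (deriv T (of_real x))" for x
  define \<psi>2 where "\<psi>2 x = Re (deriv (deriv T) (of_real x))" for x
  have d\<psi>: "(\<psi> has_real_derivative \<psi>1 x) (at x)" "(\<psi>1 has_real_derivative \<psi>2 x) (at x)"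
    if "0 \<le> x" "x < \<rho>" for x
    unfolding \<psi>_def \<psi>1_def \<psi>2_def using that holT
    by (auto intro!: has_real_derivative_Re_of_real holomorphic_derivI[OF _ open_ball] holomorphic_deriv)
  define v where "v = axis_incl (vec 1)"
  obtain e h H where e: "e > 0"
    and h: "\<And>z. cmod z < e \<Longrightarrow> (h has_derivative (\<lambda>v. v *\<^sub>C H z)) (at z)"
    and g: "\<And>z. cmod z < e \<Longrightarrow> kahler_metric fubini_study_potential (h z) (H z) (H z)
       = \<alpha> * taub_nut_metric m (0 + z *\<^sub>C v) v v"
    using kahler_immersion_along_line[OF F, of 0 v] by metis
  have metric: "\<alpha> * taub_nut_metric m (0 + z *\<^sub>C v) v v
      = \<psi>1 ((cmod z)\<^sup>2) + (cmod z)\<^sup>2 * \<psi>2 ((cmod z)\<^sup>2)" if z: "(cmod z)\<^sup>2 < \<rho>" for z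
  proof -
    have "0 + z *\<^sub>C v = axis_incl (vec z)"
      by (simp add: v_def axis_incl_def scaleC_vec_def scaleC_complex_def vec_eq_iff forall_2)
    then have "taub_nut_metric m (0 + z *\<^sub>C v) v v
        = kahler_metric (\<lambda>z. taub_nut_potential m (axis_incl z)) (vec z) (vec 1) (vec 1)"
      unfolding kahler_metric_axis by (simp add: taub_nut_metric_def v_def)
    \<comment> \<open>\<open>T\<close> already contains the factor \<alpha>, whereas
      \<open>taub_nut_metric\<close> comes from the unscaled potential; hence the division.\<close>
    also have "\<dots> = \<psi>1 ((cmod z)\<^sup>2) / \<alpha> + (cmod z)\<^sup>2 * (\<psi>2 ((cmod z)\<^sup>2) / \<alpha>)"
    proof (rule radial_metric[where \<psi> = "\<lambda>x. \<psi> x / \<alpha>" and ?\<psi>1.0 = "\<lambda>x. \<psi>1 x / \<alpha>"])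
      show "taub_nut_potential m (axis_incl z) = \<psi> ((cmod (z $ 1))\<^sup>2) / \<alpha>"
        if "(cmod (z $ 1))\<^sup>2 < \<rho>" for z :: "complex ^ 1"
        using T[OF that] \<alpha> by (simp add: \<psi>_def)
    qed (use z d\<psi> in \<open>auto intro!: DERIV_cdivide\<close>)
    finally show ?thesis using \<alpha> by (simp add: field_simps)
  qed
  obtain r0 \<mu> a where r0: "0 < r0" "r0 < e" and \<mu>: "summable (\<lambda>j. (\<mu> j)\<^sup>2)"
    "\<And>j z. cmod z < r0 \<Longrightarrow> cmod (coord (h z) j) \<le> \<mu> j"
    and hol: "\<And>j. (\<lambda>z. coord (h z) j) holomorphic_on ball 0 r0"
    and M: "\<And>z. cmod z < r0 \<Longrightarrow> ((\<lambda>z. cinner (H z) (h z)) has_derivative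
       (\<lambda>v. a z * v + of_real ((norm (H z))\<^sup>2) * cnj v)) (at z)"
    by (rule ell2_curve_derivatives[of e h H, OF e h]) (assumption, rule that)
  define r where "r = min r0 (sqrt \<rho>)"
  have r: "r > 0" "r \<le> r0" "r < e" using r0 \<rho> by (auto simp: r_def)
  have "r \<le> sqrt \<rho>" by (simp add: r_def)
  then have r_sq: "r\<^sup>2 \<le> \<rho>"
    using r(1) \<rho> power_mono[of r "sqrt \<rho>" 2] by simp
  have sq: "(cmod z)\<^sup>2 < \<rho>" if "cmod z < r" for z
    using power_strict_mono[OF that norm_ge_zero, of 2] r_sq by simp
  obtain G where holG: "G holomorphic_on ball 0 r"
    and G: "\<And>z. cmod z < r \<Longrightarrow> exp (\<psi> ((cmod z)\<^sup>2)) = (cmod (G z))\<^sup>2 * (1 + (norm (h z))\<^sup>2)"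
  proof (rule exp_potential_factor[OF r(1), of h H a \<psi> \<psi>1 \<psi>2])
    fix z assume z: "cmod z < r"
    show "(norm (H z))\<^sup>2 / (1 + (norm (h z))\<^sup>2) - (cmod (cinner (H z) (h z)))\<^sup>2 / (1 + (norm (h z))\<^sup>2)\<^sup>2
        = \<psi>1 ((cmod z)\<^sup>2) + (cmod z)\<^sup>2 * \<psi>2 ((cmod z)\<^sup>2)"
      using g[of z] metric[OF sq[OF z]] z r unfolding fubini_study_metric by simp
  qed (use h M d\<psi> r r_sq in auto)
  have "continuous_on (cball 0 (r / 2)) G"
    using holomorphic_on_imp_continuous_on[OF holG] by (rule continuous_on_subset) (use r in auto)
  then have "bounded (G ` cball 0 (r / 2))"
    by (intro compact_imp_bounded compact_continuous_image) auto
  then obtain K where K: "\<And>z. cmod z \<le> r / 2 \<Longrightarrow> cmod (G z) \<le> K"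
    unfolding bounded_iff by fastforce
  \<comment> \<open>Index 0 carries the summand 1 of \<open>1 + (norm (h z))\<^sup>2\<close>; the
    coordinates of \<open>h\<close> are shifted by one.\<close>
  define gs where "gs j = (case j of 0 \<Rightarrow> G | Suc i \<Rightarrow> (\<lambda>z. G z * coord (h z) i))" for j
  define \<nu> where "\<nu> j = (case j of 0 \<Rightarrow> K | Suc i \<Rightarrow> K * \<mu> i)" for j
  have "0 \<le> Re (fps_nth (fps_expansion (\<lambda>x. exp (T x)) 0) n)"
  proof (rule sum_norm_squares_coeff_nonneg[of "r / 2" \<rho> gs \<nu>])
    show "r / 2 > 0" using r by simp
    have "(r / 2)\<^sup>2 \<le> r\<^sup>2" using r by (intro power_mono) auto
    then show "(r / 2)\<^sup>2 \<le> \<rho>" using r_sq by linarith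
    show "gs j holomorphic_on ball 0 (r / 2)" for j
    proof -
      have "G holomorphic_on ball 0 (r / 2)"
        by (rule holomorphic_on_subset[OF holG]) (use r in auto)
      moreover have "(\<lambda>z. coord (h z) i) holomorphic_on ball 0 (r / 2)" for i
        by (rule holomorphic_on_subset[OF hol]) (use r in auto)
      ultimately show ?thesis by (cases j) (auto simp: gs_def intro!: holomorphic_on_mult)
    qed
    show "cmod (gs j z) \<le> \<nu> j" if z: "cmod z < r / 2" for j z
    proof (cases j)
      case (Suc i)
      have "cmod (G z) \<le> K" "cmod (coord (h z) i) \<le> \<mu> i" using K \<mu>(2) z r by auto
      then show ?thesis using Suc by (auto simp: gs_def \<nu>_def norm_mult intro!: mult_mono intro: order_trans[OF norm_ge_zero])
    qed (use K z in \<open>simp add: gs_def \<nu>_def\<close>)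
    have "summable (\<lambda>i. (\<nu> (Suc i))\<^sup>2)"
      unfolding \<nu>_def by (simp add: power_mult_distrib summable_mult \<mu>(1))
    then show "summable (\<lambda>j. (\<nu> j)\<^sup>2)" by (subst (asm) summable_Suc_iff)
    show "(\<lambda>x. exp (T x)) holomorphic_on ball 0 \<rho>" by (intro holomorphic_intros holT)
    fix z assume "cmod z < r / 2"
    then have z: "cmod z < r" using r by simp
    have "(\<lambda>i. (cmod (coord (h z) i))\<^sup>2) sums (norm (h z))\<^sup>2"
      unfolding norm_ell2_sq by (rule summable_sums[OF summable_coord])
    from sums_mult[OF this, of "(cmod (G z))\<^sup>2"]
    have "(\<lambda>i. (cmod (gs (Suc i) z))\<^sup>2) sums ((cmod (G z))\<^sup>2 * (norm (h z))\<^sup>2)"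
      by (simp add: gs_def norm_mult power_mult_distrib)
    then have "(\<lambda>j. (cmod (gs j z))\<^sup>2) sums ((cmod (G z))\<^sup>2 * (norm (h z))\<^sup>2 + (cmod (gs 0 z))\<^sup>2)"
      by (rule sums_Suc)
    also have "(cmod (G z))\<^sup>2 * (norm (h z))\<^sup>2 + (cmod (gs 0 z))\<^sup>2 = exp (\<psi> ((cmod z)\<^sup>2))"
      unfolding G[OF z] by (simp add: gs_def algebra_simps)
    finally have "(\<lambda>j. complex_of_real ((cmod (gs j z))\<^sup>2)) sums of_real (exp (\<psi> ((cmod z)\<^sup>2)))"
      by (rule sums_of_real)
    moreover have "T (of_real ((cmod z)\<^sup>2)) = of_real (\<psi> ((cmod z)\<^sup>2))"
      using T[of "vec z"] sq[OF z] by (simp add: \<psi>_def del: of_real_power)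
    ultimately show "(\<lambda>j. complex_of_real ((cmod (gs j z))\<^sup>2)) sums exp (T (of_real ((cmod z)\<^sup>2)))"
      by (simp only: exp_of_real)
  qed
  with n show False by simp
qed

theorem theorem1:
  fixes m \<alpha> :: real
  assumes "m > 0" and "\<alpha> > 0"
  shows "(\<forall>N. \<not> (\<exists>F. kahler_immersion (\<lambda>p X Y. \<alpha> * taub_nut_metric m p X Y) N F)) \<and>
         (\<forall>N. \<not> one_resolvable (\<lambda>z. \<alpha> * taub_nut_potential m (axis_incl z)) 0 N)"
  using taub_nut_no_kahler_immersion[OF assms] axis_not_one_resolvable[OF assms] by blast

end
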